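(* Let $k$ be an algebraically closed field of characteristic zero and let $L$ be an $n$-dimensional filiform Lie algebra over $k$. If $n\le 11$, then $L$ satisfies Rentschler's property.
   Context: Let $C^1(L)=L$, $C^i(L)=[L,C^{i-1}(L)]$ for $i\ge 2$, be the descending central series. An $n$-dimensional Lie algebra $L$ is filiform if $\dim C^i(L)=n-i$ for $i=2,\dots,n$. For $\xi\in L^*$ put $L(\xi)=\{x\in L : \xi([x,y])=0 \text{ for all } y\in L\}$; the index is $i(L)=\min_{\xi\in L^*}\dim L(\xi)$; the magic number is $c(L)=(\dim L+i(L))/2$ (an integer). $\alpha(L)$ denotes the maximum dimension of an abelian subalgebra of $L$. $L$ satisfies Rentschler's property if $\alpha(L)\ge c(L)-1$. *)

theory Defs
  imports "HOL-Computational_Algebra.Computational_Algebra"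
begin

text \<open>The underlying space of the Lie algebra is the whole type \<open>'l\<close>, so \<open>UNIV\<close> plays the role of \<open>L\<close>.\<close>

locale lie_algebra = vector_space scale
  for scale :: "'k::field \<Rightarrow> 'l::ab_group_add \<Rightarrow> 'l" +
  fixes br :: "'l \<Rightarrow> 'l \<Rightarrow> 'l"
  assumes br_add_left: "br (x + y) z = br x z + br y z"
    and br_add_right: "br x (y + z) = br x y + br x z"
    and br_scale_left: "br (scale a x) y = scale a (br x y)"
    and br_scale_right: "br x (scale a y) = scale a (br x y)"
    and br_self: "br x x = 0"
    and jacobi: "br x (br y z) + br y (br z x) + br z (br x y) = 0"
begin

definition bracket_space :: "'l set \<Rightarrow> 'l set \<Rightarrow> 'l set" where
  "bracket_space A B = span {br x y | x y. x \<in> A \<and> y \<in> B}"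

text \<open>The series is indexed from \<open>C\<^sup>1(L) = L\<close>; the value at \<open>0\<close> is a dummy.\<close>

fun lower_central :: "nat \<Rightarrow> 'l set" where
  "lower_central 0 = UNIV"
| "lower_central (Suc 0) = UNIV"
| "lower_central (Suc (Suc i)) = bracket_space UNIV (lower_central (Suc i))"

definition filiform :: bool where
  "filiform \<longleftrightarrow> (\<forall>i\<in>{2..dim UNIV}. dim (lower_central i) = dim UNIV - i)"

definition dual :: "('l \<Rightarrow> 'k) set" where
  "dual = {\<xi>. Vector_Spaces.linear scale (*) \<xi>}"

definition stabilizer :: "('l \<Rightarrow> 'k) \<Rightarrow> 'l set" where
  "stabilizer \<xi> = {x. \<forall>y. \<xi> (br x y) = 0}"

text \<open>An infimum of natural numbers over the nonempty set \<open>dual\<close> is a minimum.\<close>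

definition lie_index :: nat where
  "lie_index = (INF \<xi>\<in>dual. dim (stabilizer \<xi>))"

definition magic_number :: rat where
  "magic_number = (of_nat (dim UNIV) + of_nat lie_index) / 2"

definition subalgebra :: "'l set \<Rightarrow> bool" where
  "subalgebra A \<longleftrightarrow> subspace A \<and> (\<forall>x\<in>A. \<forall>y\<in>A. br x y \<in> A)"

definition abelian_subalgebra :: "'l set \<Rightarrow> bool" where
  "abelian_subalgebra A \<longleftrightarrow> subalgebra A \<and> (\<forall>x\<in>A. \<forall>y\<in>A. br x y = 0)"

text \<open>In finite dimension the set below is finite, and it contains \<open>dim {0} = 0\<close>.\<close>

definition alpha :: nat where
  "alpha = Max {dim A | A. abelian_subalgebra A}"

definition rentschler_property :: bool where
  "rentschler_property \<longleftrightarrow> of_nat alpha \<ge> magic_number - 1"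

end

locale finite_dimensional_lie_algebra =
  lie_algebra scale br + finite_dimensional_vector_space scale Basis
  for scale :: "'k::field \<Rightarrow> 'l::ab_group_add \<Rightarrow> 'l"
    and br :: "'l \<Rightarrow> 'l \<Rightarrow> 'l" and Basis :: "'l set"

end

theory Submission
  imports Defs
begin

text \<open>
  Rentschler's property compares a lower bound with an upper bound. Let \<open>\<omega>\<close> be the alternating form
  \<open>\<xi> [x, y]\<close> of a linear form \<open>\<xi>\<close>. If \<open>\<omega>\<close> is nondegenerate on the span of \<open>2 k\<close> vectors, then the index is at
  most \<open>n - 2 k\<close> and the magic number is at most \<open>n - k\<close>, so that an abelian subalgebra of dimension
  \<open>n - k - 1\<close> suffices (\<open>rentschler_property_if_nondegenerate\<close>).

  A filiform algebra of dimension \<open>n \<ge> 3\<close> has a basis \<open>e\<^sub>1, \<dots>, e\<^sub>n\<close> such that \<open>[e\<^sub>1, e\<^sub>i] = e\<^bsub>i+1\<^esub>\<close> for \<open>i \<ge> 2\<close>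
  (\<open>adapted_basis_exists\<close>). For \<open>i \<ge> 3\<close> the space \<open>F i\<close> spanned by \<open>e\<^sub>i, \<dots>, e\<^sub>n\<close> is \<open>C\<^bsup>i-1\<^esup>(L)\<close>; its dimension
  is \<open>n + 1 - i\<close>. These are the candidates for abelian subalgebras. The aim is that whenever \<open>F (k + 2)\<close> is
  abelian and \<open>F (k + 1)\<close> is not, some \<open>\<omega>\<close> is nondegenerate on \<open>2 k\<close> vectors.

  After a normalisation of \<open>e\<^sub>2\<close>, Vergne's argument (\<open>br_e_fine\<close>) gives \<open>[e\<^sub>i, e\<^sub>j] \<in> F (i + j)\<close>, with a
  possible exception on the antidiagonal \<open>i + j = n + 1\<close>. In the exceptional case all entries of this
  antidiagonal are nonzero, the dual vector \<open>e\<^sub>n\<^sup>*\<close> has rank at least \<open>n - 2\<close>, and the upper half of the basis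
  commutes.

  In the regular case \<open>F 6\<close> is abelian, because \<open>6 + 7 > 11\<close>; hence only \<open>k \<le> 4\<close> occurs. If \<open>k > 1\<close>, the
  bracket \<open>[e\<^bsub>k+1\<^esub>, e\<^bsub>k+2\<^esub>]\<close> is nonzero (\<open>abelian_F_step\<close>). Let \<open>N\<close> be the index of its leading term and let
  \<open>\<xi>\<close> vanish on \<open>F (N + 1)\<close> but not at \<open>e\<^sub>N\<close>. The vectors \<open>e\<^sub>1\<close> and \<open>e\<^bsub>N-1\<^esub>\<close> form a hyperbolic pair
  (\<open>nondegenerate_on_frame\<close>), so rank \<open>2 k - 2\<close> is needed on the vectors in between.
  For \<open>k = 1\<close> the hyperbolic pair with \<open>N = n\<close> is enough, and for \<open>k = 2\<close> the pair \<open>e\<^sub>3, e\<^sub>4\<close> serves.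
  For \<open>k = 3\<close> either the Pfaffian on \<open>e\<^sub>2, e\<^sub>3, e\<^sub>4, e\<^sub>5\<close> is a
  nonzero polynomial along a pencil \<open>e\<^sub>N\<^sup>* + t e\<^sub>p\<^sup>*\<close>, or \<open>e\<^sub>3, e\<^sub>4, e\<^sub>5, e\<^sub>6\<close> serve with \<open>\<xi> = e\<^sub>N\<^sup>*\<close>. For \<open>k = 4\<close>
  necessarily \<open>n = N = 11\<close>; here the Jacobi identities between leading coefficients show that at
  most one of the four pairs on the antidiagonal \<open>i + j = 11\<close> can vanish (\<open>antidiagonal_eleven\<close>).
\<close>

section \<open>Nondegenerate alternating matrices\<close>

text \<open>
  The matrix is indexed by natural numbers because it will be the Gram matrix of an alternating
  form on a subfamily \<open>J\<close> of a numbered family of vectors.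
\<close>

definition nondegenerate_on :: "(nat \<Rightarrow> nat \<Rightarrow> 'k::field) \<Rightarrow> nat set \<Rightarrow> bool" where
  "nondegenerate_on \<omega> J \<longleftrightarrow>
     (\<forall>a. (\<forall>j\<in>J. (\<Sum>i\<in>J. a i * \<omega> i j) = 0) \<longrightarrow> (\<forall>i\<in>J. a i = 0))"

text \<open>
  Solving the columns \<open>w - i\<close> in increasing order of \<open>i\<close> eliminates the unknowns one at a time.
  A graded bracket has such a matrix: a form that kills all weights above \<open>w\<close> vanishes below the
  antidiagonal \<open>i + j = w\<close>.
\<close>

lemma nondegenerate_on_antitriangular:
  fixes \<omega> :: "nat \<Rightarrow> nat \<Rightarrow> 'k::field"
  assumes fin: "finite J"
    and mirror: "\<And>i. i \<in> J \<Longrightarrow> i \<le> w \<and> w - i \<in> J \<and> \<omega> i (w - i) \<noteq> 0"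
    and below: "\<And>i j. i \<in> J \<Longrightarrow> j \<in> J \<Longrightarrow> w < i + j \<Longrightarrow> \<omega> i j = 0"
  shows "nondegenerate_on \<omega> J"
  unfolding nondegenerate_on_def
proof (intro allI impI ballI)
  fix a i
  assume eqs: "\<forall>j\<in>J. (\<Sum>i\<in>J. a i * \<omega> i j) = 0" and "i \<in> J"
  then show "a i = 0"
  proof (induction i rule: less_induct)
    case (less i)
    have i: "i \<le> w" "w - i \<in> J" "\<omega> i (w - i) \<noteq> 0"
      using mirror less.prems by auto
    have "a i' * \<omega> i' (w - i) = 0" if "i' \<in> J - {i}" for i'
    proof (cases "i' < i")
      case True
      then show ?thesis using less that by auto
    next
      case False
      then have "w < i' + (w - i)" using that i by auto
      then show ?thesis using below that i by auto
    qed
    then have "(\<Sum>i'\<in>J - {i}. a i' * \<omega> i' (w - i)) = 0"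
      by (intro sum.neutral) blast
    then have "(\<Sum>i'\<in>J. a i' * \<omega> i' (w - i)) = a i * \<omega> i (w - i)"
      using fin less.prems(2) by (simp add: sum.remove)
    then show ?case using less.prems i by auto
  qed
qed

text \<open>
  Column \<open>q\<close> contains only the unknown \<open>a p\<close>. Once this unknown is zero, the columns of \<open>J\<close> are the
  old system, and column \<open>p\<close> then gives \<open>a q = 0\<close>. The entries \<open>\<omega> p j\<close> are arbitrary.
\<close>

lemma nondegenerate_on_hyperbolic_extension:
  fixes \<omega> :: "nat \<Rightarrow> nat \<Rightarrow> 'k::field"
  assumes J: "nondegenerate_on \<omega> J" "finite J" and pq: "p \<notin> J" "q \<notin> J" "p \<noteq> q"
    and "\<omega> p q \<noteq> 0" "\<omega> q p \<noteq> 0" "\<omega> q q = 0"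
    and qJ: "\<And>j. j \<in> J \<Longrightarrow> \<omega> q j = 0 \<and> \<omega> j q = 0"
  shows "nondegenerate_on \<omega> (insert p (insert q J))"
  unfolding nondegenerate_on_def
proof (intro allI impI)
  fix a
  assume eqs: "\<forall>j\<in>insert p (insert q J). (\<Sum>i\<in>insert p (insert q J). a i * \<omega> i j) = 0"
  have eq: "a p * \<omega> p j + (a q * \<omega> q j + (\<Sum>i\<in>J. a i * \<omega> i j)) = 0"
    if "j \<in> insert p (insert q J)" for j
    using eqs that J pq by auto
  have "a p = 0" using eq[of q] assms by simp
  then have "(\<Sum>i\<in>J. a i * \<omega> i j) = 0" if "j \<in> J" for j
    using eq[of j] qJ[of j] that by simp
  then have aJ: "\<forall>i\<in>J. a i = 0"
    using J unfolding nondegenerate_on_def by blast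
  then have "a q = 0" using eq[of p] \<open>a p = 0\<close> assms by simp
  then show "\<forall>i\<in>insert p (insert q J). a i = 0" using aJ \<open>a p = 0\<close> by auto
qed

text \<open>
  The determinant of an alternating matrix of size four is the square of the Pfaffian in the last
  assumption. Stated with the Pfaffian, the criterion is only quadratic in a parameter of the form.
\<close>

lemma nondegenerate_on_pfaffian:
  fixes \<omega> :: "nat \<Rightarrow> nat \<Rightarrow> 'k::field"
  assumes alt: "\<And>i. \<omega> i i = 0" "\<And>i j. \<omega> j i = - \<omega> i j"
    and dist: "distinct [a, b, c, d]"
    and pf: "\<omega> a b * \<omega> c d - \<omega> a c * \<omega> b d + \<omega> a d * \<omega> b c \<noteq> 0"
  shows "nondegenerate_on \<omega> {a, b, c, d}"
  unfolding nondegenerate_on_def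
proof (intro allI impI)
  fix x
  assume eqs: "\<forall>j\<in>{a, b, c, d}. (\<Sum>i\<in>{a, b, c, d}. x i * \<omega> i j) = 0"
  let ?P = "\<omega> a b * \<omega> c d - \<omega> a c * \<omega> b d + \<omega> a d * \<omega> b c"
  have eq: "x a * \<omega> a j + x b * \<omega> b j + x c * \<omega> c j + x d * \<omega> d j = 0"
    if "j \<in> {a, b, c, d}" for j
    using eqs that dist by (auto simp: add.assoc)
  have s: "\<omega> b a = - \<omega> a b" "\<omega> c a = - \<omega> a c" "\<omega> d a = - \<omega> a d"
    "\<omega> c b = - \<omega> b c" "\<omega> d b = - \<omega> b d" "\<omega> d c = - \<omega> c d"
    by (rule alt(2))+
  have E: "- x b * \<omega> a b - x c * \<omega> a c - x d * \<omega> a d = 0"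
    "x a * \<omega> a b - x c * \<omega> b c - x d * \<omega> b d = 0"
    "x a * \<omega> a c + x b * \<omega> b c - x d * \<omega> c d = 0"
    "x a * \<omega> a d + x b * \<omega> b d + x c * \<omega> c d = 0"
    using eq[of a] eq[of b] eq[of c] eq[of d] by (simp_all add: alt(1) s)
  \<comment> \<open>The rows of the Pfaffian adjoint: each eliminates all unknowns but one.\<close>
  have "x a * ?P = 0" "x b * ?P = 0" "x c * ?P = 0" "x d * ?P = 0"
    using E by algebra+
  then show "\<forall>i\<in>{a, b, c, d}. x i = 0" using pf by auto
qed

lemma quadratic_nonroot:
  fixes a b c :: "'k::field_char_0"
  assumes "b \<noteq> 0 \<or> c \<noteq> 0"
  obtains t where "a + b * t + c * t\<^sup>2 \<noteq> 0"
proof -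
  have "\<not> (a = 0 \<and> a + b + c = 0 \<and> a - b + c = 0)"
  proof
    assume "a = 0 \<and> a + b + c = 0 \<and> a - b + c = 0"
    then have "2 * b = 0" "2 * c = 0" by algebra+
    then show False using assms by simp
  qed
  then consider "a \<noteq> 0" | "a + b + c \<noteq> 0" | "a - b + c \<noteq> 0" by blast
  then show ?thesis
    by cases (use that[of 0] that[of 1] that[of "-1"] in simp_all)
qed

section \<open>Lie algebras, stabilizers and the index\<close>

context lie_algebra
begin

lemma br_zero_left [simp]: "br 0 y = 0"
  using br_add_left[of 0 0 y] by simp

lemma br_zero_right [simp]: "br y 0 = 0"
  using br_add_right[of y 0 0] by simp

lemma br_minus_left: "br (- x) y = - br x y"
  using br_add_left[of x "- x" y] by (simp add: eq_neg_iff_add_eq_0 add.commute)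

lemma br_minus_right: "br x (- y) = - br x y"
  using br_add_right[of x y "- y"] by (simp add: eq_neg_iff_add_eq_0 add.commute)

lemma br_diff_left: "br (x - z) y = br x y - br z y"
  using br_add_left[of x "- z" y] by (simp add: br_minus_left)

lemma br_diff_right: "br x (y - z) = br x y - br x z"
  using br_add_right[of x y "- z"] by (simp add: br_minus_right)

lemma br_anticommute: "br x y = - br y x"
proof -
  have "br x y + br y x = br (x + y) (x + y)"
    unfolding br_add_left br_add_right by (simp add: br_self)
  also have "\<dots> = 0" by (rule br_self)
  finally have "br x y + br y x = 0" .
  then show ?thesis by (simp add: eq_neg_iff_add_eq_0)
qed

lemma br_derivation: "br x (br y z) = br (br x y) z + br y (br x z)"
proof -
  have "br y (br z x) = - br y (br x z)" "br z (br x y) = - br (br x y) z"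
    using br_anticommute[of z x] br_anticommute[of z "br x y"] by (simp_all add: br_minus_right)
  then show ?thesis using jacobi[of x y z] by (simp add: algebra_simps)
qed

lemma br_sum_left: "br (\<Sum>i\<in>I. f i) y = (\<Sum>i\<in>I. br (f i) y)"
  by (induction I rule: infinite_finite_induct) (auto simp: br_add_left)

lemma br_in_subspace:
  assumes W: "subspace W" and AB: "\<And>x y. x \<in> A \<Longrightarrow> y \<in> B \<Longrightarrow> br x y \<in> W"
    and x: "x \<in> span A" and y: "y \<in> span B"
  shows "br x y \<in> W"
proof -
  have "subspace {x. \<forall>y\<in>B. br x y \<in> W}"
    using W by (auto simp: subspace_def br_add_left br_scale_left)
  with AB have "span A \<subseteq> {x. \<forall>y\<in>B. br x y \<in> W}"
    by (intro span_minimal) auto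
  with x have "B \<subseteq> {y. br x y \<in> W}" by auto
  moreover have "subspace {y. br x y \<in> W}"
    using W by (auto simp: subspace_def br_add_right br_scale_right)
  ultimately have "span B \<subseteq> {y. br x y \<in> W}" by (rule span_minimal)
  with y show ?thesis by auto
qed

lemma subspace_stabilizer:
  assumes "\<xi> \<in> dual"
  shows "subspace (stabilizer \<xi>)"
proof -
  interpret f: Vector_Spaces.linear scale "(*)" \<xi> using assms by (simp add: dual_def)
  show ?thesis
    by (auto simp: subspace_def stabilizer_def br_add_left br_scale_left f.add f.scale f.zero)
qed

lemma span_image_sums:
  assumes "finite J" "x \<in> span (u ` J)"
  shows "\<exists>a. x = (\<Sum>i\<in>J. scale (a i) (u i))"
  using assms
proof (induction J arbitrary: x rule: finite_induct)
  case (insert i J)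
  obtain k where "x - scale k (u i) \<in> span (u ` J)"
    using insert.prems by (auto simp: span_insert)
  then obtain a where "x - scale k (u i) = (\<Sum>j\<in>J. scale (a j) (u j))"
    using insert.IH by blast
  then have "x = (\<Sum>j\<in>insert i J. scale ((a(i := k)) j) (u j))"
    using insert.hyps by (auto simp: diff_eq_eq add.commute intro!: sum.cong)
  then show ?case by blast
qed auto

text \<open>
  The stabilizer is the radical of the form \<open>\<xi> [x, y]\<close>, so it meets the span of the \<open>u i\<close> only in zero.
\<close>

lemma nondegenerate_combination_not_in_stabilizer:
  assumes "\<xi> \<in> dual"
    and nd: "nondegenerate_on (\<lambda>i j. \<xi> (br (u i) (u j))) J"
    and s: "(\<Sum>i\<in>J. scale (a i) (u i)) \<in> stabilizer \<xi>"
    and "i \<in> J"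
  shows "a i = 0"
proof -
  interpret f: Vector_Spaces.linear scale "(*)" \<xi> using assms by (simp add: dual_def)
  have "(\<Sum>i\<in>J. a i * \<xi> (br (u i) (u j))) = 0" for j
    using s by (simp add: stabilizer_def br_sum_left f.sum br_scale_left f.scale)
  then show ?thesis using nd \<open>i \<in> J\<close> unfolding nondegenerate_on_def by blast
qed

lemma lie_index_le_dim_stabilizer: "\<xi> \<in> dual \<Longrightarrow> lie_index \<le> dim (stabilizer \<xi>)"
  unfolding lie_index_def by (rule cINF_lower) auto

end

context finite_dimensional_lie_algebra
begin

lemma dim_le_UNIV: "dim A \<le> dim UNIV"
  by (rule dim_subset) simp

text \<open>
  Each \<open>u i\<close> adds one to the dimension of the span of the stabilizer and its predecessors, since a
  relation would put a nontrivial combination of the \<open>u i\<close> into the stabilizer.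
\<close>

lemma dim_stabilizer_plus_card_le:
  assumes xi: "\<xi> \<in> dual" and J: "finite J"
    and nd: "nondegenerate_on (\<lambda>i j. \<xi> (br (u i) (u j))) J"
  shows "dim (stabilizer \<xi>) + card J \<le> dim UNIV"
proof -
  let ?S = "stabilizer \<xi>"
  have "finite I \<Longrightarrow> I \<subseteq> J \<Longrightarrow> dim (?S \<union> u ` I) = dim ?S + card I" for I
  proof (induction I rule: finite_induct)
    case (insert i I)
    have "u i \<notin> span (?S \<union> u ` I)"
    proof
      assume "u i \<in> span (?S \<union> u ` I)"
      moreover have "span ?S = ?S"
        using span_eq_iff subspace_stabilizer[OF xi] by blast
      ultimately obtain s y where "u i = s + y" "s \<in> ?S" "y \<in> span (u ` I)"
        unfolding span_Un by auto
      then obtain a where a: "u i = s + (\<Sum>j\<in>I. scale (a j) (u j))" "s \<in> ?S"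
        using span_image_sums insert by blast
      define b where "b j = (if j = i then 1 else if j \<in> I then - a j else 0)" for j
      have "(\<Sum>j\<in>J. scale (b j) (u j)) = (\<Sum>j\<in>insert i I. scale (b j) (u j))"
        using insert.prems J by (intro sum.mono_neutral_right) (auto simp: b_def)
      also have "\<dots> = u i + (\<Sum>j\<in>I. scale (- a j) (u j))"
        using insert.hyps by (auto simp: b_def intro!: sum.cong)
      also have "\<dots> = s" using a by (simp add: sum_negf)
      finally have "b i = 0"
        using nondegenerate_combination_not_in_stabilizer[OF xi nd, of b i] a insert.prems by auto
      then show False by (simp add: b_def)
    qed
    then have "dim (insert (u i) (?S \<union> u ` I)) = dim (?S \<union> u ` I) + 1"
      by (simp add: dim_insert)
    then show ?case using insert by simp
  qed simp
  from this[of J] J have "dim (?S \<union> u ` J) = dim ?S + card J" by simp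
  then show ?thesis using dim_le_UNIV[of "?S \<union> u ` J"] by simp
qed

lemma dim_abelian_le_alpha:
  assumes "abelian_subalgebra A"
  shows "dim A \<le> alpha"
proof -
  have "{dim A | A. abelian_subalgebra A} \<subseteq> {..dim UNIV}"
    using dim_le_UNIV by auto
  then have "finite {dim A | A. abelian_subalgebra A}" by (rule finite_subset) simp
  then show ?thesis unfolding alpha_def using assms by (intro Max_ge) auto
qed

text \<open>
  The two ways to bound the quantities in Rentschler's property: an abelian subalgebra bounds
  \<open>alpha\<close> from below, a form of rank \<open>card J\<close> bounds the index by \<open>dim UNIV - card J\<close> from above.
  All later cases reduce to producing a suitable pair.
\<close>

lemma rentschler_property_if_nondegenerate:
  assumes A: "abelian_subalgebra A" and xi: "\<xi> \<in> dual" and J: "finite J"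
    and nd: "nondegenerate_on (\<lambda>i j. \<xi> (br (u i) (u j))) J"
    and le: "2 * dim UNIV \<le> 2 * dim A + card J + 2"
  shows rentschler_property
proof -
  have "lie_index + card J \<le> dim UNIV"
    using dim_stabilizer_plus_card_le[OF xi J nd] lie_index_le_dim_stabilizer[OF xi] by linarith
  then have "dim UNIV + lie_index \<le> 2 * alpha + 2"
    using le dim_abelian_le_alpha[OF A] by linarith
  then have "(of_nat (dim UNIV + lie_index) :: rat) \<le> of_nat (2 * alpha + 2)"
    using of_nat_le_iff by blast
  then show ?thesis by (simp add: rentschler_property_def magic_number_def field_simps)
qed

end

text \<open>
  An algebra of dimension two is abelian here, because \<open>C\<^sup>2\<close> has dimension zero. Below that, the zero
  subalgebra suffices, since the magic number is at most one.
\<close>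

lemma (in finite_dimensional_lie_algebra) rentschler_property_small_dim:
  assumes filiform "dim UNIV \<le> 2"
  shows rentschler_property
proof (rule rentschler_property_if_nondegenerate[where J = "{}" and \<xi> = "\<lambda>_. 0"])
  have "br x y = 0" if d: "dim UNIV = 2" for x y
  proof -
    have "dim (lower_central 2) = 0" using assms(1) d unfolding filiform_def by auto
    then have "lower_central 2 \<subseteq> {0}" by simp
    moreover have "br x y \<in> lower_central 2"
      by (auto simp: numeral_2_eq_2 bracket_space_def intro!: span_base)
    ultimately show ?thesis by auto
  qed
  then have "abelian_subalgebra (if dim UNIV = 2 then UNIV else {0})"
    by (auto simp: abelian_subalgebra_def subalgebra_def br_self simp del: dim_UNIV)
  then show "abelian_subalgebra (if dim UNIV = 2 then UNIV else {0})" .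
  show "2 * dim UNIV \<le> 2 * dim (if dim UNIV = 2 then UNIV else {0}) + card ({} :: nat set) + 2"
    using assms(2) by (auto simp del: dim_UNIV)
  show "(\<lambda>_. 0) \<in> dual"
    unfolding dual_def Vector_Spaces.linear_iff
    using vector_space_axioms by (auto simp: vector_space_def algebra_simps)
qed (auto simp: nondegenerate_on_def)

section \<open>Adapted bases and Vergne's normal form\<close>

text \<open>
  The index \<open>1\<close> of the first basis vector has to survive simplification.
\<close>

declare One_nat_def [simp del]

text \<open>
  The basis starts at \<open>e 1\<close>, and \<open>e i = 0\<close> beyond \<open>n\<close>, so that \<open>e_Suc\<close> also says \<open>[e\<^sub>1, e\<^sub>n] = 0\<close>.
  The assumption \<open>br_e2\<close> is what the inclusions \<open>[L, C\<^sup>i] \<subseteq> C\<^bsup>i+1\<^esup>\<close> leave to be required of \<open>e\<^sub>2\<close>. The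
  assumption \<open>br_e2_e3\<close> is a normalisation of \<open>e\<^sub>2\<close>: a multiple of \<open>e\<^sub>1\<close> can be subtracted from it to
  cancel the coefficient of \<open>e\<^sub>4\<close>.
\<close>

locale filiform_adapted_basis = finite_dimensional_lie_algebra scale br Basis
  for scale :: "'k::field_char_0 \<Rightarrow> 'l::ab_group_add \<Rightarrow> 'l"
    and br :: "'l \<Rightarrow> 'l \<Rightarrow> 'l" and Basis :: "'l set" +
  fixes e :: "nat \<Rightarrow> 'l" and n :: nat
  assumes dim_n: "dim UNIV = n" and n_ge_3: "3 \<le> n"
    and e_Suc: "2 \<le> i \<Longrightarrow> e (Suc i) = br (e 1) (e i)"
    and e_vanish: "n < i \<Longrightarrow> e i = 0"
    and span_e: "span (e ` {1..n}) = UNIV"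
    and br_e2: "3 \<le> j \<Longrightarrow> br (e 2) (e j) \<in> span (e ` {Suc j..})"
    and br_e2_e3: "br (e 2) (e 3) \<in> span (e ` {5..})"
begin

definition F :: "nat \<Rightarrow> 'l set" where
  "F i = span (e ` {i..})"

definition coord :: "nat \<Rightarrow> 'l \<Rightarrow> 'k" where
  "coord m v = representation (e ` {1..n}) v (e m)"

abbreviation struct_const :: "nat \<Rightarrow> nat \<Rightarrow> nat \<Rightarrow> 'k" where
  "struct_const i j m \<equiv> coord m (br (e i) (e j))"

lemma card_e: "card (e ` {1..n}) = n"
proof (rule antisym)
  show "card (e ` {1..n}) \<le> n" using card_image_le[of "{1..n}" e] by simp
  show "n \<le> card (e ` {1..n})"
    using dim_le_card[of UNIV "e ` {1..n}"] span_e dim_n by simp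
qed

lemma independent_e: "independent (e ` {1..n})"
  by (rule card_le_dim_spanning[of _ UNIV]) (use span_e card_e dim_n in auto)

lemma inj_on_e: "inj_on e {1..n}"
  by (rule eq_card_imp_inj_on) (use card_e in auto)

lemma coord_add: "coord m (x + y) = coord m x + coord m y"
  unfolding coord_def using representation_add[OF independent_e] span_e by auto

lemma coord_scale: "coord m (scale a x) = a * coord m x"
  unfolding coord_def using representation_scale[OF independent_e] span_e by auto

lemma coord_zero [simp]: "coord m 0 = 0"
  using coord_scale[of m 0 0] by simp

lemma coord_minus [simp]: "coord m (- x) = - coord m x"
  using coord_scale[of m "-1" x] by simp

lemma coord_diff: "coord m (x - y) = coord m x - coord m y"
  using coord_add[of m x "- y"] by simp

lemma coord_e:
  assumes "1 \<le> i" "1 \<le> m" "m \<le> n"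
  shows "coord m (e i) = (if i = m then 1 else 0)"
proof (cases "i \<le> n")
  case True
  then have "e i \<in> e ` {1..n}" using assms by auto
  then have "coord m (e i) = (if e m = e i then 1 else 0)"
    unfolding coord_def by (simp add: representation_basis[OF independent_e])
  moreover have "e m = e i \<longleftrightarrow> m = i"
    by (rule inj_on_eq_iff[OF inj_on_e]) (use True assms in auto)
  ultimately show ?thesis by (simp add: eq_commute)
next
  case False
  then show ?thesis using assms e_vanish[of i] by simp
qed

lemma sum_coord: "(\<Sum>i=1..n. scale (coord i v) (e i)) = v"
proof -
  have "v = (\<Sum>b\<in>e ` {1..n}. scale (representation (e ` {1..n}) v b) b)"
    using sum_representation_eq[OF independent_e, of v "e ` {1..n}"] span_e by simp
  also have "\<dots> = (\<Sum>i=1..n. scale (coord i v) (e i))"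
    by (simp add: sum.reindex[OF inj_on_e] coord_def)
  finally show ?thesis by simp
qed

lemma coord_pencil_in_dual: "(\<lambda>v. coord m v + t * coord p v) \<in> dual"
  unfolding dual_def Vector_Spaces.linear_iff
  using vector_space_axioms
  by (auto simp: coord_add coord_scale algebra_simps vector_space_def)

lemma coord_in_dual: "coord m \<in> dual"
  using coord_pencil_in_dual[of m 0 m] by simp

lemma subspace_F: "subspace (F i)"
  by (simp add: F_def)

lemma F_antimono: "i \<le> j \<Longrightarrow> F j \<subseteq> F i"
  unfolding F_def by (rule span_mono) auto

lemma e_in_F: "i \<le> j \<Longrightarrow> e j \<in> F i"
  unfolding F_def by (rule span_base) auto

lemma subspace_coord_vanish: "subspace {v. \<forall>m\<in>M. coord m v = 0}"
  by (auto simp: subspace_def coord_add coord_scale)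

lemma F_iff:
  assumes "1 \<le> i"
  shows "v \<in> F i \<longleftrightarrow> (\<forall>m\<in>{1..n} \<inter> {..<i}. coord m v = 0)"
proof
  have "F i \<subseteq> {v. \<forall>m\<in>{1..n} \<inter> {..<i}. coord m v = 0}"
    unfolding F_def using assms by (intro span_minimal subspace_coord_vanish) (auto simp: coord_e)
  then show "v \<in> F i \<Longrightarrow> \<forall>m\<in>{1..n} \<inter> {..<i}. coord m v = 0" by auto
next
  assume v: "\<forall>m\<in>{1..n} \<inter> {..<i}. coord m v = 0"
  have "scale (coord m v) (e m) \<in> F i" if "m \<in> {1..n}" for m
  proof (cases "m < i")
    case True
    then show ?thesis using v that subspace_0[OF subspace_F] by auto
  next
    case False
    then show ?thesis using e_in_F subspace_scale[OF subspace_F] by auto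
  qed
  then have "(\<Sum>m=1..n. scale (coord m v) (e m)) \<in> F i"
    by (intro subspace_sum[OF subspace_F]) auto
  then show "v \<in> F i" by (simp add: sum_coord)
qed

lemma coord_eq_0: "v \<in> F i \<Longrightarrow> 1 \<le> m \<Longrightarrow> m \<le> n \<Longrightarrow> m < i \<Longrightarrow> coord m v = 0"
  using F_iff[of i v] by auto

lemma F_trivial: "n < i \<Longrightarrow> v \<in> F i \<Longrightarrow> v = 0"
  using F_iff[of i v] sum_coord[of v] by auto

lemma F_SucI: "v \<in> F i \<Longrightarrow> 1 \<le> i \<Longrightarrow> coord i v = 0 \<Longrightarrow> v \<in> F (Suc i)"
  by (auto simp: F_iff less_Suc_eq)

lemma leading_index:
  assumes "v \<noteq> 0"
  obtains N where "1 \<le> N" "N \<le> n" "coord N v \<noteq> 0" "v \<in> F N"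
proof -
  let ?P = "\<lambda>m. 1 \<le> m \<and> m \<le> n \<and> coord m v \<noteq> 0"
  have "\<exists>m. ?P m"
  proof (rule ccontr)
    assume "\<nexists>m. ?P m"
    then have "(\<Sum>i=1..n. scale (coord i v) (e i)) = 0" by (intro sum.neutral) auto
    then show False using assms sum_coord by simp
  qed
  then obtain N where N: "?P N" and least: "\<And>m. m < N \<Longrightarrow> \<not> ?P m"
    using exists_least_iff[of ?P] by blast
  then have "v \<in> F N" by (subst F_iff) auto
  then show ?thesis using that N by blast
qed

lemma dim_F:
  assumes "1 \<le> i"
  shows "dim (F i) = n + 1 - i"
proof -
  have "e j \<in> insert 0 (e ` {i..n})" if "i \<le> j" for j
    using e_vanish[of j] that by (cases "n < j") auto
  then have "span (e ` {i..}) \<subseteq> span (insert 0 (e ` {i..n}))"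
    by (intro span_mono) auto
  then have "F i = span (e ` {i..n})"
    unfolding F_def by (intro antisym) (simp, intro span_mono, auto)
  moreover have "independent (e ` {i..n})" "inj_on e {i..n}"
    using independent_e inj_on_e assms by (auto elim!: independent_mono inj_on_subset)
  ultimately show ?thesis using dim_span_eq_card_independent card_image by fastforce
qed

lemma br_e1_F: 
  assumes "2 \<le> j" "v \<in> F j"
  shows "br (e 1) v \<in> F (Suc j)"
proof -
  have "br (e 1) (e i) \<in> F (Suc j)" if "j \<le> i" for i
    using that e_Suc[of i] assms e_in_F[of "Suc j" "Suc i"] by auto
  then show ?thesis
    using br_in_subspace[OF subspace_F, of "{e 1}" "e ` {j..}" "Suc j" "e 1" v] assms
    by (auto simp: F_def span_base)
qed

lemma coord_br_e1:
  assumes "2 \<le> m" "m < n" "v \<in> F 2"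
  shows "coord (Suc m) (br (e 1) v) = coord m v"
proof -
  have "subspace {v. coord (Suc m) (br (e 1) v) = coord m v}"
    by (auto simp: subspace_def br_add_right br_scale_right coord_add coord_scale)
  moreover have "coord (Suc m) (br (e 1) (e i)) = coord m (e i)" if "2 \<le> i" for i
    using that assms e_Suc[of i, symmetric] by (simp add: coord_e)
  ultimately have "F 2 \<subseteq> {v. coord (Suc m) (br (e 1) v) = coord m v}"
    unfolding F_def by (intro span_minimal) auto
  then show ?thesis using assms by auto
qed

lemma e_derivation:
  assumes "2 \<le> i" "2 \<le> j"
  shows "br (e 1) (br (e i) (e j)) = br (e (Suc i)) (e j) + br (e i) (e (Suc j))"
  using assms br_derivation[of "e 1" "e i" "e j"] e_Suc[of i] e_Suc[of j] by simp

text \<open>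
  The weight estimate that holds without any normalisation: only the case \<open>i = 2\<close> uses the lower
  central series, and \<open>ad e\<^sub>1\<close> transports it to all larger \<open>i\<close>. It misses the grading \<open>F (i + j)\<close>
  by one.
\<close>

lemma br_e_coarse:
  assumes "2 \<le> i" "2 \<le> j" "m < i + j"
  shows "br (e i) (e j) \<in> F m"
proof -
  have "br (e i) (e (Suc l)) \<in> F (i + l)" if "1 \<le> l" for l
    using \<open>2 \<le> i\<close> that
  proof (induction i arbitrary: l rule: dec_induct)
    case base
    then consider "l = 1" | "3 \<le> Suc l" by linarith
    then show ?case
    proof cases
      case 1
      then show ?thesis
        using br_self[of "e 2"] subspace_0[OF subspace_F] by (simp add: numeral_2_eq_2[symmetric])
    next
      case 2
      then show ?thesis using br_e2[of "Suc l"] by (simp add: F_def)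
    qed
  next
    case (step i)
    have "br (e 1) (br (e i) (e (Suc l))) \<in> F (Suc (i + l))" "br (e i) (e (Suc (Suc l))) \<in> F (i + Suc l)"
      using step.IH[of l] step.IH[of "Suc l"] step.hyps step.prems by (auto intro!: br_e1_F)
    moreover have "br (e (Suc i)) (e (Suc l)) = br (e 1) (br (e i) (e (Suc l))) - br (e i) (e (Suc (Suc l)))"
      using e_derivation[of i "Suc l"] step.hyps step.prems by simp
    ultimately show ?case using subspace_diff[OF subspace_F] by simp
  qed
  from this[of "j - 1"] show ?thesis
    using assms F_antimono[of m "i + (j - 1)"] by (cases j) auto
qed

lemma br_F_mono:
  assumes "\<And>a b. i \<le> a \<Longrightarrow> j \<le> b \<Longrightarrow> br (e a) (e b) \<in> F m" "x \<in> F i" "y \<in> F j"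
  shows "br x y \<in> F m"
  using br_in_subspace[OF subspace_F, of "e ` {i..}" "e ` {j..}" m x y] assms by (auto simp: F_def)

lemma br_F_coarse:
  assumes "2 \<le> i" "2 \<le> j" "m < i + j" "x \<in> F i" "y \<in> F j"
  shows "br x y \<in> F m"
proof (rule br_F_mono[OF _ assms(4,5)])
  fix a b assume "i \<le> a" "j \<le> b"
  then show "br (e a) (e b) \<in> F m"
    using br_e_coarse[of a b m] assms by linarith
qed

lemma struct_const_derivation:
  assumes "2 \<le> i" "2 \<le> j" "2 \<le> m" "m < n"
  shows "struct_const i j m = struct_const (Suc i) j (Suc m) + struct_const i (Suc j) (Suc m)"
proof -
  have "br (e i) (e j) \<in> F 2"
    using br_e_coarse[of i j 2] assms by simp
  then have "struct_const i j m = coord (Suc m) (br (e 1) (br (e i) (e j)))"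
    using coord_br_e1[of m] assms by simp
  then show ?thesis using assms by (simp add: e_derivation coord_add)
qed

lemma struct_const_skew: "struct_const j i m = - struct_const i j m"
  using br_anticommute[of "e j" "e i"] by simp

lemma struct_const_self [simp]: "struct_const i i m = 0"
  by (simp add: br_self)

text \<open>
  If all higher terms of \<open>v\<close> are pushed beyond weight \<open>m\<close>, only the leading term of \<open>v\<close> is seen.
  This lets Jacobi identities be evaluated in the associated graded algebra.
\<close>

lemma coord_br_leading:
  assumes "v \<in> F r" "1 \<le> r" "r \<le> n" "1 \<le> m" "m \<le> n"
    and next_F: "\<And>w. w \<in> F (Suc r) \<Longrightarrow> br (e i) w \<in> F (Suc m)"
  shows "coord m (br (e i) v) = coord r v * struct_const i r m"
proof -
  let ?w = "v - scale (coord r v) (e r)"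
  have "?w \<in> F (Suc r)"
    using assms e_in_F[of r r] subspace_diff[OF subspace_F] subspace_scale[OF subspace_F]
    by (intro F_SucI) (auto simp: coord_diff coord_scale coord_e)
  then have "coord m (br (e i) ?w) = 0"
    using next_F assms coord_eq_0[of _ "Suc m" m] by auto
  then show ?thesis by (simp add: br_diff_right br_scale_right coord_diff coord_scale)
qed

lemma abelian_F:
  assumes "\<And>a b. i \<le> a \<Longrightarrow> i \<le> b \<Longrightarrow> br (e a) (e b) = 0"
  shows "abelian_subalgebra (F i)"
proof -
  have "br x y = 0" if "x \<in> F i" "y \<in> F i" for x y
    using br_in_subspace[of "{0}" "e ` {i..}" "e ` {i..}" x y] assms that by (auto simp: F_def)
  then show ?thesis
    using subspace_F subspace_0[OF subspace_F] by (simp add: abelian_subalgebra_def subalgebra_def)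
qed

text \<open>
  If the bracket has no component of weight \<open>i + j - 1\<close> on one antidiagonal, the derivation rule says
  that consecutive entries of the next antidiagonal cancel. The next antidiagonal is thus determined
  by one scalar.
\<close>

lemma antidiagonal_alternates:
  assumes prev: "\<forall>i\<ge>2. \<forall>j\<ge>2. i + j = s \<longrightarrow> br (e i) (e j) \<in> F s"
    and s: "4 \<le> s" "s \<le> n" and i: "2 \<le> i" "i < s"
  shows "struct_const i (Suc s - i) s = (- 1) ^ i * struct_const 2 (s - 1) s"
  using i
proof (induction i rule: dec_induct)
  case base
  then have "Suc s - 2 = s - 1" "(- 1) ^ 2 = (1::'k)" using s by auto
  then show ?case by (simp only: mult_1)
next
  case (step i)
  have "struct_const i (s - i) (s - 1) = 0"
    using prev[rule_format, of i "s - i"] coord_eq_0[of "br (e i) (e (s - i))" s "s - 1"] step s by auto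
  moreover have "struct_const i (s - i) (s - 1)
      = struct_const (Suc i) (s - i) s + struct_const i (Suc s - i) s"
    using struct_const_derivation[of i "s - i" "s - 1"] step s by (simp add: Suc_diff_le)
  ultimately have "struct_const (Suc i) (s - i) s = - struct_const i (Suc s - i) s"
    by (simp add: eq_neg_iff_add_eq_0)
  moreover have "Suc s - Suc i = s - i" by simp
  ultimately show ?case using step.IH step.prems by simp
qed

text \<open>
  When the antidiagonal \<open>i + j = s + 1\<close> has a middle entry \<open>[e\<^sub>h, e\<^sub>h] = 0\<close>, that scalar is zero.
\<close>

lemma antidiagonal_even_vanishes:
  assumes prev: "\<forall>i\<ge>2. \<forall>j\<ge>2. i + j = s \<longrightarrow> br (e i) (e j) \<in> F s"
    and s: "4 \<le> s" "s \<le> n" "odd s"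
  shows "struct_const 2 (s - 1) s = 0"
proof -
  have "even (Suc s)" using s(3) by simp
  then obtain h where h: "Suc s = 2 * h" by (rule evenE)
  then have "Suc s - h = h" by simp
  then have "struct_const h (Suc s - h) s = 0" by simp
  moreover have "2 \<le> h" "h < s" using h s by auto
  ultimately show ?thesis using antidiagonal_alternates[OF prev s(1,2), of h] by simp
qed

text \<open>
  The remaining antidiagonals have odd \<open>i + j = s + 1\<close>. The first of them consists of the brackets
  of \<open>e\<^sub>2\<close> and \<open>e\<^sub>3\<close> and vanishes by the normalisation of \<open>e\<^sub>2\<close>; the others vanish as long as the
  target weight \<open>s + 1\<close> of the following antidiagonal still occurs in the basis.
  Let \<open>\<alpha>\<close> be the scalar of the antidiagonal and \<open>\<beta> i\<close> the
  entries of the following one. Jacobi on \<open>e\<^sub>2, e\<^sub>3, e\<^bsub>s-2\<^esub>\<close> gives \<open>\<alpha> * \<beta> 2 = 0\<close>. If \<open>\<alpha> \<noteq> 0\<close>, the derivation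
  rule then forces \<open>\<beta> i = \<plusminus> (i - 2) \<alpha>\<close>, which contradicts the vanishing of the middle entry, because
  the characteristic is zero.
\<close>

lemma br_e_fine_step:
  assumes prev: "\<forall>i\<ge>2. \<forall>j\<ge>2. i + j \<le> s \<longrightarrow> br (e i) (e j) \<in> F (i + j)"
    and s: "4 \<le> s" "s < n"
  shows "struct_const 2 (s - 1) s = 0"
proof (rule ccontr)
  define \<alpha> where "\<alpha> = struct_const 2 (s - 1) s"
  define \<beta> where "\<beta> i = struct_const i (s + 2 - i) (Suc s)" for i
  assume nz: "struct_const 2 (s - 1) s \<noteq> 0"
  have prev': "\<forall>i\<ge>2. \<forall>j\<ge>2. i + j = s \<longrightarrow> br (e i) (e j) \<in> F s" using prev by auto
  have alt: "struct_const i (Suc s - i) s = (- 1) ^ i * \<alpha>" if "2 \<le> i" "i < s" for i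
    unfolding \<alpha>_def using antidiagonal_alternates[OF prev' s(1), of i] that s by auto
  have "even s" using nz antidiagonal_even_vanishes[OF prev' s(1)] s by auto
  moreover have "s \<noteq> 4"
    using nz br_e2_e3 coord_eq_0[of "br (e 2) (e 3)" 5 4] s by (auto simp: F_def)
  ultimately have s6: "6 \<le> s" using s by presburger
  \<comment> \<open>Two of the three Jacobi terms have weight above \<open>s + 1\<close>.\<close>
  have "Suc (Suc (s - 2)) = s" using s6 by simp
  then have "br (e 3) (br (e (s - 2)) (e 2)) \<in> F (s + 2)"
    using br_F_coarse[of 3 s "s + 2" "e 3" "br (e (s - 2)) (e 2)"] prev[rule_format, of "s - 2" 2] e_in_F[of 3 3] s6 by simp
  moreover have "br (e (s - 2)) (br (e 2) (e 3)) \<in> F (s + 2)"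
    using br_F_coarse[of "s - 2" 5 "s + 2" "e (s - 2)" "br (e 2) (e 3)"] br_e2_e3 e_in_F[of "s - 2" "s - 2"] s6
    by (simp add: F_def)
  ultimately have "coord (Suc s) (br (e 2) (br (e 3) (e (s - 2)))) = 0"
    using arg_cong[OF jacobi[of "e 2" "e 3" "e (s - 2)"], of "coord (Suc s)"] s
      coord_eq_0[of _ "s + 2" "Suc s"] by (simp add: coord_add)
  moreover have "coord (Suc s) (br (e 2) (br (e 3) (e (s - 2)))) = struct_const 3 (s - 2) s * \<beta> 2"
    unfolding \<beta>_def using br_e_coarse[of 3 "s - 2" s] s6 s e_in_F[of 2 2] br_F_coarse[of 2 "Suc s" "s + 2" "e 2"]
    by (subst coord_br_leading[of _ s]) auto
  ultimately have "\<beta> 2 = 0" using alt[of 3] nz s6 by (simp add: \<alpha>_def)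
  have \<beta>: "\<beta> i = (- 1) ^ Suc i * of_nat (i - 2) * \<alpha>" if "2 \<le> i" "i < Suc s" for i
    using that
  proof (induction i rule: dec_induct)
    case base
    then show ?case using \<open>\<beta> 2 = 0\<close> by simp
  next
    case (step i)
    have "(- 1) ^ i * \<alpha> = \<beta> (Suc i) + \<beta> i"
      using struct_const_derivation[of i "Suc s - i" s] alt[of i] step s
      by (simp add: \<beta>_def Suc_diff_le)
    moreover have "\<beta> i = (- 1) ^ Suc i * of_nat (i - 2) * \<alpha>" using step by simp
    moreover have "Suc i - 2 = Suc (i - 2)" using step by simp
    ultimately show ?case by (simp add: algebra_simps eq_diff_eq)
  qed
  obtain h where h: "s = 2 * h" using \<open>even s\<close> by (rule evenE)
  then have "s + 2 - Suc h = Suc h" by simp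
  then have "\<beta> (Suc h) = 0" by (simp add: \<beta>_def)
  then show False using \<beta>[of "Suc h"] nz h s6 by (simp add: \<alpha>_def)
qed

lemma F_of_antidiagonal:
  assumes prev: "\<forall>i\<ge>2. \<forall>j\<ge>2. i + j = s \<longrightarrow> br (e i) (e j) \<in> F s"
    and s: "4 \<le> s" "s \<le> n" and zero: "struct_const 2 (s - 1) s = 0"
    and ij: "2 \<le> i" "2 \<le> j" "i + j = Suc s"
  shows "br (e i) (e j) \<in> F (i + j)"
proof -
  have "j = Suc s - i" "i < s" using ij by auto
  then have "struct_const i j s = 0"
    using antidiagonal_alternates[OF prev s, of i] ij zero by simp
  then show ?thesis using br_e_coarse[of i j s] ij F_SucI[of _ s] s by auto
qed

text \<open>
  Vergne's normal form: the bracket respects the grading in which \<open>e i\<close> has weight \<open>i\<close>, except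
  possibly on the last antidiagonal \<open>i + j = n + 1\<close>.
\<close>

lemma br_e_fine: "2 \<le> i \<Longrightarrow> 2 \<le> j \<Longrightarrow> i + j \<le> n \<Longrightarrow> br (e i) (e j) \<in> F (i + j)"
proof (induction "i + j" arbitrary: i j rule: less_induct)
  case less
  show ?case
  proof (cases "i + j = 4")
    case True
    then have "i = 2" "j = 2" using less.prems by auto
    then show ?thesis by (simp add: br_self subspace_0[OF subspace_F])
  next
    case False
    obtain s where s: "i + j = Suc s" using less.prems by (cases "i + j") auto
    have prev: "\<forall>i\<ge>2. \<forall>j\<ge>2. i + j \<le> s \<longrightarrow> br (e i) (e j) \<in> F (i + j)"
      using less.hyps less.prems(3) unfolding s by (metis le_imp_less_Suc less_imp_le order_trans)
    have s4: "4 \<le> s" "s < n" using False less.prems s by auto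
    show ?thesis
    proof (rule F_of_antidiagonal[OF _ s4(1) _ br_e_fine_step[OF prev s4]])
      show "\<forall>i\<ge>2. \<forall>j\<ge>2. i + j = s \<longrightarrow> br (e i) (e j) \<in> F s" using prev by auto
    qed (use s4 s less.prems in auto)
  qed
qed

text \<open>
  If the last antidiagonal does not vanish, all its entries are nonzero, so \<open>e\<^sub>n\<^sup>*\<close> has the large rank
  \<open>n - 2\<close>. Moreover \<open>n\<close> is even, and the upper half of the basis spans an abelian subalgebra by the
  coarse weight estimate.
\<close>

lemma rentschler_property_if_exceptional:
  assumes nz: "struct_const 2 (n - 1) n \<noteq> 0"
  shows rentschler_property
proof -
  have n4: "4 \<le> n"
  proof (rule ccontr)
    assume "\<not> 4 \<le> n"
    then have "n - 1 = 2" using n_ge_3 by simp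
    then show False using nz by simp
  qed
  have prev: "\<forall>i\<ge>2. \<forall>j\<ge>2. i + j = n \<longrightarrow> br (e i) (e j) \<in> F n"
    using br_e_fine by auto
  then have "even n" using antidiagonal_even_vanishes[of n] nz n4 by auto
  then obtain h where h: "n = 2 * h" by (rule evenE)
  have "abelian_subalgebra (F (Suc h))"
  proof (rule abelian_F)
    fix a b assume "Suc h \<le> a" "Suc h \<le> b"
    then show "br (e a) (e b) = 0"
      using br_e_coarse[of a b "Suc n"] F_trivial[of "Suc n"] h n4 by auto
  qed
  moreover have "nondegenerate_on (\<lambda>i j. struct_const i j n) {2..<n}"
  proof (rule nondegenerate_on_antitriangular[where w = "Suc n"])
    fix i assume "i \<in> {2..<n}"
    then show "i \<le> Suc n \<and> Suc n - i \<in> {2..<n} \<and>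
        struct_const i (Suc n - i) n \<noteq> 0"
      using antidiagonal_alternates[OF prev n4 order_refl, of i] nz n4 by auto
  next
    fix i j assume "i \<in> {2..<n}" "j \<in> {2..<n}" "Suc n < i + j"
    then show "struct_const i j n = 0"
      using br_e_coarse[of i j "Suc n"] F_trivial[of "Suc n" "br (e i) (e j)"] by auto
  qed auto
  ultimately show ?thesis
    using coord_in_dual[of n] dim_F[of "Suc h"] h n4
    by (intro rentschler_property_if_nondegenerate[where J = "{2..<n}" and u = e and \<xi> = "coord n"]) (auto simp: dim_n simp del: dim_UNIV)
qed

end

section \<open>The regular case\<close>

locale regular_adapted_basis = filiform_adapted_basis scale br Basis e n
  for scale :: "'k::field_char_0 \<Rightarrow> 'l::ab_group_add \<Rightarrow> 'l"
    and br :: "'l \<Rightarrow> 'l \<Rightarrow> 'l" and Basis :: "'l set" and e n +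
  assumes br_e: "2 \<le> i \<Longrightarrow> 2 \<le> j \<Longrightarrow> br (e i) (e j) \<in> F (i + j)"
begin

lemma br_F:
  assumes "2 \<le> i" "2 \<le> j" "x \<in> F i" "y \<in> F j"
  shows "br x y \<in> F (i + j)"
proof (rule br_F_mono[OF _ assms(3,4)])
  fix a b assume "i \<le> a" "j \<le> b"
  then show "br (e a) (e b) \<in> F (i + j)"
    using br_e[of a b] F_antimono[of "i + j" "a + b"] assms by auto
qed

lemma struct_const_eq_0: "2 \<le> i \<Longrightarrow> 2 \<le> j \<Longrightarrow> 1 \<le> m \<Longrightarrow> m \<le> n \<Longrightarrow> m < i + j \<Longrightarrow> struct_const i j m = 0"
  using br_e[of i j] coord_eq_0[of "br (e i) (e j)" "i + j" m] by auto

lemma br_e_above: "2 \<le> i \<Longrightarrow> 2 \<le> j \<Longrightarrow> n < i + j \<Longrightarrow> br (e i) (e j) = 0"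
  using br_e[of i j] F_trivial[of "i + j"] by auto

text \<open>
  As \<open>e\<^bsub>i+1\<^esub>\<close> commutes with \<open>F (i + 1)\<close>, applying \<open>ad e\<^sub>1\<close> to \<open>[e\<^sub>i, e\<^sub>j]\<close> yields \<open>[e\<^sub>i, e\<^bsub>j+1\<^esub>]\<close>. Hence
  one vanishing bracket propagates along the whole row.
\<close>

lemma abelian_F_step:
  assumes i: "2 \<le> i" and ab: "abelian_subalgebra (F (Suc i))" and zero: "br (e i) (e (Suc i)) = 0"
  shows "abelian_subalgebra (F i)"
proof -
  have ab0: "br (e a) (e b) = 0" if "i < a" "i < b" for a b
    using ab that e_in_F[of "Suc i"] by (auto simp: abelian_subalgebra_def)
  have row: "br (e i) (e (Suc i + m)) = 0" for m
  proof (induction m)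
    case 0
    then show ?case using zero by simp
  next
    case (Suc m)
    then show ?case
      using e_derivation[of i "Suc i + m"] ab0[of "Suc i" "Suc i + m"] i by simp
  qed
  have row': "br (e i) (e a) = 0" if "i \<le> a" for a
  proof (cases "a = i")
    case False
    then show ?thesis using row[of "a - Suc i"] that by simp
  qed (simp add: br_self)
  show ?thesis
  proof (rule abelian_F)
    fix a b assume ab: "i \<le> a" "i \<le> b"
    show "br (e a) (e b) = 0"
    proof (cases "a = i \<or> b = i")
      case True
      then show ?thesis using row'[of a] row'[of b] br_anticommute[of "e a" "e i"] ab by auto
    next
      case False
      then show ?thesis using ab0[of a b] ab by simp
    qed
  qed
qed

text \<open>
  The vector \<open>e\<^bsub>N-1\<^esub>\<close> is orthogonal to every \<open>e\<^sub>j\<close> with \<open>j \<ge> 2\<close>, since these brackets have weight above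
  \<open>N\<close>, but it pairs with \<open>e\<^sub>1\<close> to \<open>\<xi> (e N) \<noteq> 0\<close>. So \<open>e\<^sub>1\<close> and \<open>e\<^bsub>N-1\<^esub>\<close> always contribute two to the rank.
\<close>

lemma nondegenerate_on_frame:
  assumes xi: "\<xi> \<in> dual" "\<And>v. v \<in> F (Suc N) \<Longrightarrow> \<xi> v = 0" "\<xi> (e N) \<noteq> 0"
    and N: "3 \<le> N"
    and J: "nondegenerate_on (\<lambda>i j. \<xi> (br (e i) (e j))) J" "J \<subseteq> {2..N - 2}"
  shows "nondegenerate_on (\<lambda>i j. \<xi> (br (e i) (e j))) (insert 1 (insert (N - 1) J))"
proof -
  interpret xi: Vector_Spaces.linear scale "(*)" \<xi> using xi by (simp add: dual_def)
  obtain q where q: "N = Suc q" "2 \<le> q" using N by (cases N) auto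
  have e1q: "br (e 1) (e q) = e N" using e_Suc[of q] q by simp
  have eq1: "br (e q) (e 1) = - e N" using e1q br_anticommute[of "e q" "e 1"] by simp
  have vanish: "\<xi> (br (e i) (e j)) = 0" if "2 \<le> i" "2 \<le> j" "N < i + j" for i j
    using that xi br_e[of i j] F_antimono[of "Suc N" "i + j"] by auto
  have "nondegenerate_on (\<lambda>i j. \<xi> (br (e i) (e j))) (insert 1 (insert q J))"
  proof (rule nondegenerate_on_hyperbolic_extension[OF J(1)])
    show "finite J" using J(2) by (rule finite_subset) simp
    show "1 \<notin> J" "q \<notin> J" "1 \<noteq> q" using J(2) q by auto
    show "\<xi> (br (e 1) (e q)) \<noteq> 0" "\<xi> (br (e q) (e 1)) \<noteq> 0" using xi by (simp_all add: e1q eq1 xi.neg)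
    show "\<xi> (br (e q) (e q)) = 0" by (simp add: br_self xi.zero)
    show "\<xi> (br (e q) (e j)) = 0 \<and> \<xi> (br (e j) (e q)) = 0" if "j \<in> J" for j
      using vanish[of q j] vanish[of j q] that J(2) q by auto
  qed
  moreover have "N - 1 = q" using q by simp
  ultimately show ?thesis by simp
qed

lemma rentschler_property_if_frame:
  assumes A: "abelian_subalgebra (F i)" "1 \<le> i" "i \<le> n"
    and xi: "\<xi> \<in> dual" "\<And>v. v \<in> F (Suc N) \<Longrightarrow> \<xi> v = 0" "\<xi> (e N) \<noteq> 0"
    and N: "3 \<le> N"
    and J: "nondegenerate_on (\<lambda>i j. \<xi> (br (e i) (e j))) J" "J \<subseteq> {2..N - 2}"
    and card: "2 * i \<le> card J + 6"
  shows rentschler_property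
proof -
  have fin: "finite J" using J(2) by (rule finite_subset) simp
  have "N - 2 < N - 1" "1 \<noteq> N - 1" using N by linarith+
  then have "1 \<noteq> N - 1" "1 \<notin> J" "N - 1 \<notin> J" using J(2) by auto
  then have "card (insert 1 (insert (N - 1) J)) = card J + 2" using fin by simp
  moreover have "dim (F i) = n + 1 - i" using dim_F A by simp
  ultimately show ?thesis
    using nondegenerate_on_frame[OF xi N J] xi A card fin
    by (intro rentschler_property_if_nondegenerate[where u = e and A = "F i" and \<xi> = \<xi>
          and J = "insert 1 (insert (N - 1) J)"]) (auto simp: dim_n simp del: dim_UNIV)
qed

lemma rentschler_property_if_abelian_F3:
  assumes "abelian_subalgebra (F 3)"
  shows rentschler_property
proof (rule rentschler_property_if_frame[OF assms, where J = "{}" and N = n and \<xi> = "coord n"])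
  show "coord n \<in> dual" by (rule coord_in_dual)
  show "nondegenerate_on (\<lambda>i j. struct_const i j n) {}"
    by (simp add: nondegenerate_on_def)
qed (use n_ge_3 in \<open>auto simp: coord_e coord_eq_0\<close>)

text \<open>
  Besides the hyperbolic pair only rank two is missing, and the coordinate of the leading term of
  \<open>[e\<^sub>3, e\<^sub>4]\<close> supplies it on \<open>e\<^sub>3, e\<^sub>4\<close>.
\<close>

lemma rentschler_property_if_abelian_F4:
  assumes ab: "abelian_subalgebra (F 4)" and nz: "br (e 3) (e 4) \<noteq> 0"
  shows rentschler_property
proof -
  obtain N where N: "1 \<le> N" "N \<le> n" "struct_const 3 4 N \<noteq> 0" "br (e 3) (e 4) \<in> F N"
    using leading_index[OF nz] by blast
  have "7 \<le> N" using struct_const_eq_0[of 3 4 N] N by (cases "N < 7") auto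
  have "nondegenerate_on (\<lambda>i j. struct_const i j N) {3, 4}"
  proof (rule nondegenerate_on_antitriangular[where w = 7])
    show "\<And>i. i \<in> {3, 4} \<Longrightarrow> i \<le> 7 \<and> 7 - i \<in> {3, 4} \<and>
        struct_const i (7 - i) N \<noteq> 0"
      using N(3) struct_const_skew[of N 4 3] by auto
  qed auto
  then show ?thesis
    using \<open>7 \<le> N\<close> N
    by (intro rentschler_property_if_frame[OF ab, where J = "{3, 4}" and N = N and \<xi> = "coord N"])
      (auto simp: coord_e coord_eq_0 coord_in_dual)
qed

text \<open>
  Let \<open>N\<close> be the leading weight of \<open>[e\<^sub>4, e\<^sub>5]\<close>; rank four is needed on the vectors \<open>e\<^sub>2, \<dots>, e\<^sub>6\<close>.
  If \<open>[e\<^sub>2, e\<^sub>3]\<close> or \<open>[e\<^sub>3, e\<^sub>4]\<close> has a component of weight below \<open>N\<close>, take the least such weight \<open>p\<close> and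
  the pencil \<open>e\<^sub>N\<^sup>* + t e\<^sub>p\<^sup>*\<close>: by the derivation rule and the choice of \<open>p\<close>, the \<open>p\<close>-components of all brackets
  involved depend only on those two, and the Pfaffian on \<open>e\<^sub>2, e\<^sub>3, e\<^sub>4, e\<^sub>5\<close> becomes a
  nonzero polynomial in \<open>t\<close>.
  Otherwise \<open>[e\<^sub>3, e\<^sub>4]\<close> starts at weight \<open>N\<close> or later, the derivation rule gives
  \<open>[e\<^sub>3, e\<^sub>6] = - [e\<^sub>4, e\<^sub>5]\<close> at weight \<open>N\<close>, and \<open>e\<^sub>N\<^sup>*\<close> is nondegenerate on \<open>e\<^sub>3, e\<^sub>4, e\<^sub>5, e\<^sub>6\<close>.
\<close>

lemma rentschler_property_if_abelian_F5:
  assumes ab: "abelian_subalgebra (F 5)" and nz: "br (e 4) (e 5) \<noteq> 0"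
  shows rentschler_property
proof -
  obtain N where N: "1 \<le> N" "N \<le> n" "struct_const 4 5 N \<noteq> 0" "br (e 4) (e 5) \<in> F N"
    using leading_index[OF nz] by blast
  have N9: "9 \<le> N" using struct_const_eq_0[of 4 5 N] N by (cases "N < 9") auto
  have frame: rentschler_property
    if "nondegenerate_on (\<lambda>i j. coord N (br (e i) (e j)) + t * coord p (br (e i) (e j))) J"
      "J \<subseteq> {2..6}" "card J = 4" "1 \<le> p" "p < N" for t p J
  proof (rule rentschler_property_if_frame[OF ab _ _ coord_pencil_in_dual _ _ _ that(1)])
    show "coord N v + t * coord p v = 0" if "v \<in> F (Suc N)" for v
      using that \<open>1 \<le> p\<close> \<open>p < N\<close> N coord_eq_0[OF that] by auto
    show "coord N (e N) + t * coord p (e N) \<noteq> 0" using that N by (simp add: coord_e)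
    have "{2..6} \<subseteq> {2..N - 2}" using N9 by simp
    then show "J \<subseteq> {2..N - 2}" using that(2) by blast
  qed (use that N N9 in auto)
  show ?thesis
  proof (cases "\<exists>p. 2 \<le> p \<and> p < N \<and> (struct_const 2 3 p \<noteq> 0 \<or> struct_const 3 4 p \<noteq> 0)")
    case True
    then obtain p where p: "2 \<le> p" "p < N" "struct_const 2 3 p \<noteq> 0 \<or> struct_const 3 4 p \<noteq> 0"
      and minimal: "\<forall>m<p. \<not> (2 \<le> m \<and> m < N \<and> (struct_const 2 3 m \<noteq> 0 \<or> struct_const 3 4 m \<noteq> 0))"
      unfolding exists_least_iff[of "\<lambda>p. 2 \<le> p \<and> p < N \<and> _ p"] by blast
    have least: "struct_const 2 3 m = 0 \<and> struct_const 3 4 m = 0" if "m < p" "2 \<le> m" for m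
      using minimal that p(2) by auto
    have p5: "5 \<le> p"
      using p N struct_const_eq_0[of 2 3 p] struct_const_eq_0[of 3 4 p] by (cases "p < 5") auto
    obtain r where r: "p = Suc r" "4 \<le> r" using p5 by (cases p) auto
    have D: "struct_const 2 4 p = 0" "struct_const 3 5 p = 0" "struct_const 2 5 p = - struct_const 3 4 p"
    proof -
      have r0: "struct_const 2 3 r = 0" "struct_const 3 4 r = 0" using least[of r] r by auto
      show "struct_const 2 4 p = 0" "struct_const 3 5 p = 0"
        using struct_const_derivation[of 2 3 r] struct_const_derivation[of 3 4 r] r0 r p N
        by (auto simp: eval_nat_numeral One_nat_def)
      obtain s where s: "r = Suc s" "3 \<le> s" using r by (cases r) auto
      have "struct_const 2 3 s = 0" using least[of s] s r by auto
      then have "struct_const 2 4 r = 0"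
        using struct_const_derivation[of 2 3 s] s r p N by simp
      then show "struct_const 2 5 p = - struct_const 3 4 p"
        using struct_const_derivation[of 2 4 r] r p N by (simp add: add_eq_0_iff)
    qed
    have c45: "struct_const 4 5 p = 0" using coord_eq_0[OF N(4)] p N by auto
    \<comment> \<open>Only \<open>\<omega> 2 3\<close>, \<open>\<omega> 3 4\<close> and \<open>\<omega> 2 5\<close> depend on \<open>t\<close>. The coefficients of \<open>t\<close> and \<open>t\<^sup>2\<close> cannot
      both vanish: if \<open>?\<gamma> = 0\<close>, then \<open>?a1 = ?\<beta> * ?c\<close> with \<open>?\<beta>\<close> and \<open>?c\<close> nonzero.\<close>
    let ?\<omega> = "\<lambda>t i j. coord N (br (e i) (e j)) + t * coord p (br (e i) (e j))"
    let ?c = "struct_const 4 5 N" and ?\<beta> = "struct_const 2 3 p" and ?\<gamma> = "struct_const 3 4 p"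
    let ?a0 = "struct_const 2 3 N * ?c - struct_const 2 4 N * struct_const 3 5 N + struct_const 2 5 N * struct_const 3 4 N"
    let ?a1 = "?\<beta> * ?c + struct_const 2 5 N * ?\<gamma> - ?\<gamma> * struct_const 3 4 N"
    have pf: "?\<omega> t 2 3 * ?\<omega> t 4 5 - ?\<omega> t 2 4 * ?\<omega> t 3 5 + ?\<omega> t 2 5 * ?\<omega> t 3 4
        = ?a0 + ?a1 * t + (- ?\<gamma>\<^sup>2) * t\<^sup>2" for t
      by (simp add: D c45 algebra_simps power2_eq_square)
    have "?a1 \<noteq> 0 \<or> - ?\<gamma>\<^sup>2 \<noteq> 0" using p(3) N(3) by auto
    then obtain t where t: "?a0 + ?a1 * t + (- ?\<gamma>\<^sup>2) * t\<^sup>2 \<noteq> 0" by (rule quadratic_nonroot)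
    have "nondegenerate_on (?\<omega> t) {2, 3, 4, 5}"
    proof (rule nondegenerate_on_pfaffian)
      show "?\<omega> t 2 3 * ?\<omega> t 4 5 - ?\<omega> t 2 4 * ?\<omega> t 3 5 + ?\<omega> t 2 5 * ?\<omega> t 3 4 \<noteq> 0"
        using t by (subst pf)
      show "?\<omega> t j i = - ?\<omega> t i j" for i j
        using struct_const_skew[of N j i] struct_const_skew[of p j i] by (simp add: algebra_simps)
    qed auto
    then show ?thesis using p by (intro frame) auto
  next
    case False
    obtain m where m: "N = Suc (Suc m)" "7 \<le> m" using N9 by (cases N; cases "N - 1") auto
    have z34: "struct_const 3 4 (Suc m) = 0" "struct_const 3 4 m = 0" using False m by auto
    have z35: "struct_const 3 5 N = 0" "struct_const 3 5 (Suc m) = 0"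
      using struct_const_derivation[of 3 4 "Suc m"] struct_const_derivation[of 3 4 m] z34 m N by auto
    have z45: "struct_const 4 5 (Suc m) = 0" using coord_eq_0[OF N(4)] m N by auto
    have z46: "struct_const 4 6 N = 0"
      using struct_const_derivation[of 4 5 "Suc m"] z45 m N by auto
    have z36: "struct_const 3 6 N = - struct_const 4 5 N"
      using struct_const_derivation[of 3 5 "Suc m"] z35 m N by (auto simp: eq_neg_iff_add_eq_0 add.commute)
    have "br (e 5) (e 6) = 0" using ab e_in_F[of 5 5] e_in_F[of 5 6] by (auto simp: abelian_subalgebra_def)
    then have z56: "struct_const 5 6 N = 0" by simp
    have "nondegenerate_on (\<lambda>i j. struct_const i j N) {3, 4, 5, 6}"
    proof (rule nondegenerate_on_antitriangular[where w = 9])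
      show "\<And>i. i \<in> {3, 4, 5, 6} \<Longrightarrow> i \<le> 9 \<and> 9 - i \<in> {3, 4, 5, 6} \<and>
          struct_const i (9 - i) N \<noteq> 0"
        using N(3) z36 struct_const_skew[of N 5 4] struct_const_skew[of N 6 3] by auto
      show "\<And>i j. i \<in> {3, 4, 5, 6} \<Longrightarrow> j \<in> {3, 4, 5, 6} \<Longrightarrow> 9 < i + j \<Longrightarrow>
          struct_const i j N = 0"
        using z46 z56 struct_const_skew[of N 6 4] struct_const_skew[of N 6 5] by auto
    qed auto
    then show ?thesis using N9 by (intro frame[where t = 0 and p = 1 and J = "{3, 4, 5, 6}"]) auto
  qed
qed

text \<open>
  The scalars \<open>struct_const i j (i + j)\<close> are the structure constants of the associated graded Lie
  algebra, which satisfies the same identities.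
\<close>

lemma leading_const_jacobi:
  assumes ijk: "2 \<le> i" "2 \<le> j" "2 \<le> k" "i + j + k \<le> n"
  shows "struct_const j k (j + k) * struct_const i (j + k) (i + j + k)
    + struct_const k i (k + i) * struct_const j (k + i) (i + j + k)
    + struct_const i j (i + j) * struct_const k (i + j) (i + j + k) = 0"
proof -
  have lead: "coord (i + j + k) (br (e a) (br (e b) (e c))) = struct_const b c (b + c) * struct_const a (b + c) (i + j + k)"
    if "2 \<le> a" "2 \<le> b" "2 \<le> c" "a + b + c = i + j + k" for a b c
  proof (rule coord_br_leading)
    show "br (e b) (e c) \<in> F (b + c)" using br_e that by simp
    show "br (e a) w \<in> F (Suc (i + j + k))" if "w \<in> F (Suc (b + c))" for w
      using br_F[of a "Suc (b + c)" "e a" w] e_in_F[of a a] that \<open>2 \<le> a\<close> \<open>2 \<le> b\<close> \<open>a + b + c = i + j + k\<close>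
      by (simp add: add.assoc)
  qed (use that ijk in auto)
  show ?thesis
    using arg_cong[OF jacobi[of "e i" "e j" "e k"], of "coord (i + j + k)"] ijk
      lead[of i j k] lead[of j k i] lead[of k i j] by (simp add: coord_add)
qed

lemma leading_const_derivation:
  assumes "2 \<le> i" "2 \<le> j" "i + j < n"
  shows "struct_const i j (i + j) = struct_const (Suc i) j (Suc (i + j)) + struct_const i (Suc j) (Suc (i + j))"
  using struct_const_derivation[of i j "i + j"] assms by simp

text \<open>
  In the associated graded algebra all constants are integral combinations of the four numbers
  \<open>x\<^sub>1, \<dots>, x\<^sub>4\<close> on the pairs \<open>(2, 3), (3, 4), (4, 5), (5, 6)\<close>, and Jacobi on \<open>e\<^sub>2, e\<^sub>3, e\<^sub>4\<close> and on
  \<open>e\<^sub>2, e\<^sub>4, e\<^sub>5\<close> gives two quadratic equations between them. The vanishing of two entries of the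
  antidiagonal \<open>i + j = 11\<close> adds two linear equations, and the resulting homogeneous system has no
  solution with \<open>x\<^sub>4 \<noteq> 0\<close> in characteristic zero.
\<close>

lemma antidiagonal_eleven:
  assumes n: "n = 11" and nz: "struct_const 5 6 11 \<noteq> 0"
  shows "\<not> (struct_const 4 7 11 = 0 \<and> struct_const 3 8 11 = 0)"
    "\<not> (struct_const 4 7 11 = 0 \<and> struct_const 2 9 11 = 0)"
    "\<not> (struct_const 3 8 11 = 0 \<and> struct_const 2 9 11 = 0)"
proof -
  define x1 x2 x3 x4 where x: "x1 = struct_const 2 3 5" "x2 = struct_const 3 4 7"
    "x3 = struct_const 4 5 9" "x4 = struct_const 5 6 11"
  have d: "struct_const i j (i + j) = struct_const (Suc i) j (Suc (i + j)) + struct_const i (Suc j) (Suc (i + j))"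
    if "2 \<le> i" "2 \<le> j" "i + j < 11" for i j
    by (rule leading_const_derivation) (use that n in auto)
  have jac: "struct_const j k (j + k) * struct_const i (j + k) (i + j + k)
    + struct_const k i (k + i) * struct_const j (k + i) (i + j + k)
    + struct_const i j (i + j) * struct_const k (i + j) (i + j + k) = 0"
    if "2 \<le> i" "2 \<le> j" "2 \<le> k" "i + j + k \<le> 11" for i j k
    by (rule leading_const_jacobi) (use that n in auto)
  have s33: "struct_const 2 4 6 = x1" "struct_const 3 5 8 = x2" "struct_const 4 6 10 = x3"
    using d[of 2 3] d[of 3 4] d[of 4 5] by (simp_all add: x)
  have s25: "struct_const 2 5 7 = x1 - x2" "struct_const 3 6 9 = x2 - x3" "struct_const 4 7 11 = x3 - x4"
    using d[of 2 4] d[of 3 5] d[of 4 6] s33 by (simp_all add: x)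
  have s26: "struct_const 2 6 8 = x1 - 2 * x2" "struct_const 3 7 10 = x2 - 2 * x3"
    using d[of 2 5] d[of 3 6] s33 s25 by (simp_all add: algebra_simps)
  have s27: "struct_const 2 7 9 = x1 - 3 * x2 + x3" "struct_const 3 8 11 = x2 - 3 * x3 + x4"
    using d[of 2 6] d[of 3 7] s26 s25 by (simp_all add: algebra_simps)
  have s28: "struct_const 2 8 10 = x1 - 4 * x2 + 3 * x3"
    using d[of 2 7] s26 s27 by (simp_all add: algebra_simps)
  have s29: "struct_const 2 9 11 = x1 - 5 * x2 + 6 * x3 - x4"
    using d[of 2 8] s28 s27 by (simp_all add: algebra_simps)
  have "x2 * (x1 - 3 * x2 + x3) - x1 * (x2 - x3) + x1 * x3 = 0"
    using jac[of 2 3 4] s27 s25 s33 struct_const_skew[of 6 4 2] struct_const_skew[of 9 4 5]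
    by (simp flip: x)
  then have j9: "2 * x1 * x3 + x2 * x3 - 3 * x2\<^sup>2 = 0"
    by (simp add: algebra_simps power2_eq_square)
  have "x3 * (x1 - 5 * x2 + 6 * x3 - x4) + (x2 - x1) * (x3 - x4) + x1 * x4 = 0"
    using jac[of 2 4 5] s29 s25 s33 struct_const_skew[of 7 5 2] 
    by (simp flip: x)
  then have j11: "2 * x1 * x4 - x2 * x4 - x3 * x4 - 4 * x2 * x3 + 6 * x3\<^sup>2 = 0"
    by (simp add: algebra_simps power2_eq_square)
  have x4: "x4 \<noteq> 0" using nz x by simp
  show "\<not> (struct_const 4 7 11 = 0 \<and> struct_const 3 8 11 = 0)"
  proof
    assume "struct_const 4 7 11 = 0 \<and> struct_const 3 8 11 = 0"
    then have e: "x3 = x4" "x2 = 2 * x4" using s25 s27 by (auto simp: algebra_simps)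
    have "x4 * (2 * x1 - 5 * x4) = 0" using j11 unfolding e by (simp add: algebra_simps power2_eq_square)
    then have "2 * x1 = 5 * x4" using x4 by simp
    then have "x4\<^sup>2 * 5 = 0" using j9 unfolding e by algebra
    then show False using x4 by simp
  qed
  show "\<not> (struct_const 4 7 11 = 0 \<and> struct_const 2 9 11 = 0)"
  proof
    assume "struct_const 4 7 11 = 0 \<and> struct_const 2 9 11 = 0"
    then have e: "x3 = x4" "x1 = 5 * x2 - 5 * x4" using s25 s29 by (auto simp: algebra_simps)
    have "5 * (x4 * (x2 - x4)) = 0" using j11 unfolding e by algebra
    then have e2: "x2 = x4" using x4 by simp
    have "2 * x4\<^sup>2 = 0" using j9 unfolding e e2 by algebra
    then show False using x4 by simp
  qed
  show "\<not> (struct_const 3 8 11 = 0 \<and> struct_const 2 9 11 = 0)"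
  proof
    assume "struct_const 3 8 11 = 0 \<and> struct_const 2 9 11 = 0"
    then have e: "x2 = 3 * x3 - x4" "x1 = 9 * x3 - 4 * x4"
      using s27(2) s29 by algebra+
    have q: "6 * x3\<^sup>2 - 18 * x3 * x4 + 7 * x4\<^sup>2 = 0" using j11 unfolding e by algebra
    have "3 * ((x3 - x4) * (2 * x3 - x4)) = 0" using j9 unfolding e by algebra
    then have "x3 = x4 \<or> x4 = 2 * x3" by auto
    then show False
    proof
      assume "x3 = x4"
      then have "6 * x3\<^sup>2 - 18 * x3 * x4 + 7 * x4\<^sup>2 = - 5 * x4\<^sup>2"
        by (simp add: power2_eq_square algebra_simps)
      then have "- 5 * x4\<^sup>2 = 0" using q by simp
      then show False using x4 by simp
    next
      assume "x4 = 2 * x3"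
      then have "2 * x3\<^sup>2 = 0" using q unfolding \<open>x4 = 2 * x3\<close> by algebra
      then show False using x4 \<open>x4 = 2 * x3\<close> by simp
    qed
  qed
qed

text \<open>
  The bracket \<open>[e\<^sub>5, e\<^sub>6]\<close> can be nonzero only if \<open>n = 11\<close>. Then at least three of the four mirror pairs
  on the antidiagonal \<open>i + j = 11\<close> are nonzero, so \<open>e\<^sub>1\<^sub>1\<^sup>*\<close> has rank at least eight.
\<close>

lemma rentschler_property_if_abelian_F6:
  assumes ab: "abelian_subalgebra (F 6)" and nz: "br (e 5) (e 6) \<noteq> 0" and "n \<le> 11"
  shows rentschler_property
proof -
  have n: "n = 11" using br_e_above[of 5 6] nz \<open>n \<le> 11\<close> by (cases "n < 11") auto
  obtain N where "1 \<le> N" "N \<le> n" "struct_const 5 6 N \<noteq> 0" using leading_index[OF nz] by blast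
  then have nz11: "struct_const 5 6 11 \<noteq> 0"
    using struct_const_eq_0[of 5 6 N] n by (cases "N = 11") auto
  define P where "P = {i \<in> {2..9}. struct_const i (11 - i) 11 \<noteq> 0}"
  have mirror: "11 - i \<in> P" if "i \<in> P" for i
    using that struct_const_skew[of 11 "11 - i" i] by (auto simp: P_def)
  have "nondegenerate_on (\<lambda>i j. struct_const i j 11) P"
  proof (rule nondegenerate_on_antitriangular[where w = 11])
    show "finite P" by (simp add: P_def)
    show "\<And>i. i \<in> P \<Longrightarrow> i \<le> 11 \<and> 11 - i \<in> P \<and>
        struct_const i (11 - i) 11 \<noteq> 0"
      using mirror by (auto simp: P_def)
    show "\<And>i j. i \<in> P \<Longrightarrow> j \<in> P \<Longrightarrow> 11 < i + j \<Longrightarrow>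
        struct_const i j 11 = 0"
      using struct_const_eq_0 n by (auto simp: P_def)
  qed
  moreover have "6 \<le> card P"
  proof -
    have "5 \<in> P" using nz11 by (simp add: P_def)
    moreover have "4 \<in> P \<and> 3 \<in> P \<or> 4 \<in> P \<and> 2 \<in> P \<or> 3 \<in> P \<and> 2 \<in> P"
      using antidiagonal_eleven[OF n nz11] by (auto simp: P_def)
    ultimately have "{5, 6, 4, 7, 3, 8} \<subseteq> P \<or> {5, 6, 4, 7, 2, 9} \<subseteq> P \<or> {5, 6, 3, 8, 2, 9} \<subseteq> P"
      using mirror[of 5] mirror[of 4] mirror[of 3] mirror[of 2] by auto
    moreover have "card {5, 6, 4, 7, 3, 8::nat} = 6" "card {5, 6, 4, 7, 2, 9::nat} = 6"
      "card {5, 6, 3, 8, 2, 9::nat} = 6" by simp_all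
    moreover have "finite P" by (simp add: P_def)
    ultimately show ?thesis using card_mono by metis
  qed
  ultimately show ?thesis
    using eq_imp_le[OF n[symmetric]]
    by (intro rentschler_property_if_frame[OF ab, where J = P and N = 11 and \<xi> = "coord 11"])
      (auto simp: coord_e coord_eq_0 coord_in_dual P_def)
qed

text \<open>
  For the least \<open>i \<ge> 3\<close> with \<open>F i\<close> abelian, \<open>i\<close> is at most six, and if \<open>i > 3\<close> the bracket
  \<open>[e\<^bsub>i-1\<^esub>, e\<^sub>i]\<close> is nonzero, because otherwise \<open>F (i - 1)\<close> would be abelian as well.
\<close>

lemma rentschler_property_regular:
  assumes "n \<le> 11"
  shows rentschler_property
proof -
  have F6: "abelian_subalgebra (F 6)"
  proof (rule abelian_F)
    fix a b :: nat assume "6 \<le> a" "6 \<le> b"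
    then show "br (e a) (e b) = 0" using br_e_above[of a b] assms by auto
  qed
  show ?thesis
  proof (cases "br (e 5) (e 6) = 0")
    case True
    then have F5: "abelian_subalgebra (F 5)" using abelian_F_step[of 5] F6 by simp
    show ?thesis
    proof (cases "br (e 4) (e 5) = 0")
      case True
      then have F4: "abelian_subalgebra (F 4)" using abelian_F_step[of 4] F5 by simp
      show ?thesis
      proof (cases "br (e 3) (e 4) = 0")
        case True
        then have "abelian_subalgebra (F 3)" using abelian_F_step[of 3] F4 by simp
        then show ?thesis by (rule rentschler_property_if_abelian_F3)
      qed (rule rentschler_property_if_abelian_F4[OF F4])
    qed (rule rentschler_property_if_abelian_F5[OF F5])
  qed (rule rentschler_property_if_abelian_F6[OF F6 _ assms])
qed

end

text \<open>
  By Vergne's normal form the grading can fail only on the last antidiagonal, and there all entries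
  are multiples of \<open>[e\<^sub>2, e\<^bsub>n-1\<^esub>]\<close>.
\<close>

lemma (in filiform_adapted_basis) rentschler_property_if_adapted_basis:
  assumes "n \<le> 11"
  shows rentschler_property
proof (cases "struct_const 2 (n - 1) n = 0")
  case False
  then show ?thesis by (rule rentschler_property_if_exceptional)
next
  case True
  have "br (e i) (e j) \<in> F (i + j)" if ij: "2 \<le> i" "2 \<le> j" for i j
  proof -
    consider "i + j \<le> n" | "4 \<le> n" "i + j = Suc n" | "i + j = 4" | "n + 2 \<le> i + j"
      using ij n_ge_3 by linarith
    then show ?thesis
    proof cases
      case 2
      show ?thesis
        by (rule F_of_antidiagonal[of n]) (use 2 True ij br_e_fine in auto)
    next
      case 3
      then have "i = 2" "j = 2" using ij by auto
      then show ?thesis by (simp add: br_self subspace_0[OF subspace_F])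
    next
      case 4
      then have "br (e i) (e j) = 0"
        using br_e_coarse[of i j "Suc n"] F_trivial[of "Suc n"] ij by auto
      then show ?thesis by (simp add: subspace_0[OF subspace_F])
    qed (use br_e_fine ij in auto)
  qed
  then interpret regular_adapted_basis scale br Basis e n by unfold_locales
  show ?thesis using assms by (rule rentschler_property_regular)
qed

section \<open>Existence of adapted bases\<close>

text \<open>
  A line \<open>x + t y\<close> that is not contained in a subspace meets it in at most one point; this excludes
  only finitely many \<open>t\<close>.
\<close>

lemma (in vector_space) finite_subspaces_avoidable:
  assumes "infinite (UNIV :: 'a set)" and "finite I"
    and "\<And>i. i \<in> I \<Longrightarrow> subspace (K i) \<and> K i \<noteq> UNIV"
  shows "\<exists>x. \<forall>i\<in>I. x \<notin> K i"
  using assms(2,3)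
proof (induction I rule: finite_induct)
  case (insert j I)
  then obtain x where x: "\<forall>i\<in>I. x \<notin> K i" by auto
  obtain y where y: "y \<notin> K j" using insert.prems by auto
  let ?T = "\<lambda>i. {t. x + scale t y \<in> K i}"
  have "finite (?T i)" if i: "i \<in> insert j I" for i
  proof -
    have K: "subspace (K i)" using insert.prems i by auto
    have "t = t'" if t: "t \<in> ?T i" "t' \<in> ?T i" for t t'
    proof (rule ccontr)
      assume "t \<noteq> t'"
      have "(x + scale t y) - (x + scale t' y) \<in> K i"
        using t K by (intro subspace_diff) auto
      then have "scale (t - t') y \<in> K i" by (simp add: scale_left_diff_distrib)
      then have "scale (inverse (t - t')) (scale (t - t') y) \<in> K i" by (rule subspace_scale[OF K])
      then have yK: "y \<in> K i" using \<open>t \<noteq> t'\<close> by simp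
      have "(x + scale t y) - scale t y \<in> K i"
        using t(1) subspace_scale[OF K yK] by (intro subspace_diff[OF K]) auto
      then show False using x y yK i by auto
    qed
    then have "?T i \<subseteq> {t}" if "t \<in> ?T i" for t using that by blast
    then show ?thesis by (cases "?T i = {}") (auto intro: finite_subset)
  qed
  then have "finite (\<Union>i\<in>insert j I. ?T i)" using insert.hyps by blast
  then have "(\<Union>i\<in>insert j I. ?T i) \<noteq> UNIV" using assms(1) by metis
  then show ?case by blast
qed auto

locale filiform_lie_algebra = finite_dimensional_lie_algebra scale br Basis
  for scale :: "'k::field_char_0 \<Rightarrow> 'l::ab_group_add \<Rightarrow> 'l"
    and br :: "'l \<Rightarrow> 'l \<Rightarrow> 'l" and Basis :: "'l set" +
  fixes n :: nat
  assumes filiform: filiform and dim_n: "dim UNIV = n" and n_ge_3: "3 \<le> n"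
begin

lemma lower_central_Suc: "1 \<le> i \<Longrightarrow> lower_central (Suc i) = bracket_space UNIV (lower_central i)"
  by (cases i) auto

lemma subspace_lower_central: "subspace (lower_central i)"
  by (induction i rule: lower_central.induct) (auto simp: bracket_space_def)

lemma br_in_lower_central: "1 \<le> i \<Longrightarrow> y \<in> lower_central i \<Longrightarrow> br x y \<in> lower_central (Suc i)"
  by (auto simp: lower_central_Suc bracket_space_def intro!: span_base)

lemma br_in_lower_central': "1 \<le> i \<Longrightarrow> y \<in> lower_central i \<Longrightarrow> br y x \<in> lower_central (Suc i)"
  using br_in_lower_central[of i y x] br_anticommute[of y x] subspace_neg[OF subspace_lower_central]
  by auto

lemma lower_central_Suc_subset: "1 \<le> i \<Longrightarrow> lower_central (Suc i) \<subseteq> lower_central i"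
proof (induction i rule: dec_induct)
  case base
  then show ?case by (simp add: One_nat_def)
next
  case (step i)
  have "{br x y |x y. x \<in> UNIV \<and> y \<in> lower_central (Suc i)} \<subseteq> {br x y |x y. x \<in> UNIV \<and> y \<in> lower_central i}"
    using step.IH by blast
  then show ?case
    using lower_central_Suc[of i] lower_central_Suc[of "Suc i"] step.hyps
    by (simp add: bracket_space_def span_mono)
qed

lemma lower_central_antimono: "i \<le> j \<Longrightarrow> 1 \<le> i \<Longrightarrow> lower_central j \<subseteq> lower_central i"
proof (induction j rule: dec_induct)
  case (step m)
  then show ?case using lower_central_Suc_subset[of m] by auto
qed auto

lemma dim_lower_central: "2 \<le> i \<Longrightarrow> i \<le> n \<Longrightarrow> dim (lower_central i) = n - i"
  using filiform dim_n unfolding filiform_def by auto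

lemma lower_central_trivial:
  assumes "n \<le> i"
  shows "lower_central i = {0}"
proof -
  have "lower_central n \<subseteq> {0}" using dim_lower_central[of n] n_ge_3 by simp
  then show ?thesis
    using lower_central_antimono[of n i] assms n_ge_3 subspace_0[OF subspace_lower_central] by auto
qed

lemma lower_central_subset_span_insert:
  assumes "v \<in> lower_central i" "v \<notin> lower_central (Suc i)" "2 \<le> i" "i < n"
  shows "lower_central i \<subseteq> span (insert v (lower_central (Suc i)))"
proof -
  have "v \<notin> span (lower_central (Suc i))"
    using assms span_eq_iff subspace_lower_central by blast
  then have "dim (insert v (lower_central (Suc i))) = dim (lower_central i)"
    using assms by (simp add: dim_insert dim_lower_central)
  moreover have "span (insert v (lower_central (Suc i))) \<subseteq> lower_central i"
    using assms lower_central_Suc_subset[of i] by (intro span_minimal subspace_lower_central) auto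
  ultimately have "span (insert v (lower_central (Suc i))) = lower_central i"
    by (intro subspace_dim_equal subspace_lower_central) auto
  then show ?thesis by simp
qed

text \<open>
  For each \<open>i\<close> the elements that map \<open>C\<^sup>i\<close> into \<open>C\<^bsup>i+2\<^esup>\<close> form a proper subspace, as \<open>C\<^bsup>i+1\<^esup>\<close> is strictly
  larger than \<open>C\<^bsup>i+2\<^esup>\<close>.
\<close>

lemma generic_element:
  obtains x where "\<And>i. 1 \<le> i \<Longrightarrow> i + 2 \<le> n \<Longrightarrow> \<exists>y\<in>lower_central i. br x y \<notin> lower_central (i + 2)"
proof -
  define K where "K i = {x. \<forall>y\<in>lower_central i. br x y \<in> lower_central (i + 2)}" for i
  have "subspace (K i) \<and> K i \<noteq> UNIV" if "i \<in> {1..n - 2}" for i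
  proof
    show "subspace (K i)"
      using subspace_lower_central[of "i + 2"]
      by (auto simp: K_def subspace_def br_add_left br_scale_left)
    show "K i \<noteq> UNIV"
    proof
      assume "K i = UNIV"
      then have "br x y \<in> lower_central (i + 2)" if "y \<in> lower_central i" for x y
        using that by (auto simp: K_def)
      then have "{br x y |x y. x \<in> UNIV \<and> y \<in> lower_central i} \<subseteq> lower_central (i + 2)" by blast
      then have "bracket_space UNIV (lower_central i) \<subseteq> lower_central (i + 2)"
        unfolding bracket_space_def by (intro span_minimal subspace_lower_central)
      then have "lower_central (Suc i) \<subseteq> lower_central (i + 2)"
        using lower_central_Suc[of i] that by auto
      then have "dim (lower_central (Suc i)) \<le> dim (lower_central (i + 2))"
        by (rule dim_subset)
      then show False using that dim_lower_central[of "Suc i"] dim_lower_central[of "i + 2"] n_ge_3 by auto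
    qed
  qed
  then obtain x where "\<forall>i\<in>{1..n - 2}. x \<notin> K i"
    using finite_subspaces_avoidable[OF infinite_UNIV_char_0, of "{1..n - 2}" K] by auto
  then show ?thesis by (intro that[of x]) (auto simp: K_def)
qed

text \<open>
  A generic \<open>e\<^sub>1\<close> maps each one-dimensional quotient \<open>C\<^sup>i / C\<^bsup>i+1\<^esup>\<close> with \<open>2 \<le> i \<le> n - 2\<close> onto the next one, so
  iterating \<open>ad e\<^sub>1\<close> on a suitable \<open>e\<^sub>2\<close> runs through the whole series.
\<close>

lemma adapted_basis_exists: "\<exists>e. filiform_adapted_basis scale br Basis e n"
proof -
  obtain e1 where e1: "\<And>i. 1 \<le> i \<Longrightarrow> i + 2 \<le> n \<Longrightarrow> \<exists>y\<in>lower_central i. br e1 y \<notin> lower_central (i + 2)"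
    using generic_element by blast
  have advance: "br e1 v \<notin> lower_central (i + 2)"
    if v: "v \<in> lower_central i" "v \<notin> lower_central (Suc i)" and i: "2 \<le> i" "i + 2 \<le> n" for v i
  proof
    assume brv: "br e1 v \<in> lower_central (i + 2)"
    have "subspace {y. br e1 y \<in> lower_central (i + 2)}"
      using subspace_lower_central[of "i + 2"] by (auto simp: subspace_def br_add_right br_scale_right)
    then have "span (insert v (lower_central (Suc i))) \<subseteq> {y. br e1 y \<in> lower_central (i + 2)}"
      using brv br_in_lower_central[of "Suc i" _ e1] by (intro span_minimal) auto
    then have "lower_central i \<subseteq> {y. br e1 y \<in> lower_central (i + 2)}"
      using lower_central_subset_span_insert[OF v] i by auto
    then show False using e1[of i] i by auto
  qed
  obtain u where u: "br e1 u \<notin> lower_central 3"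
    using e1[of 1] n_ge_3 by auto
  have e3: "br e1 u \<in> lower_central 2"
    using br_in_lower_central[of 1 u e1] by (simp add: One_nat_def numeral_2_eq_2)
  have "\<exists>a. br u (br e1 u) - scale a (br e1 (br e1 u)) \<in> lower_central 4"
  proof (cases "n = 3")
    case True
    then have "br u (br e1 u) = 0"
      using br_in_lower_central[OF _ e3, of u] lower_central_trivial[of 3] by simp
    then show ?thesis
      using subspace_0[OF subspace_lower_central] by (intro exI[of _ 0]) simp
  next
    case False
    have "br e1 (br e1 u) \<in> lower_central 3" "br u (br e1 u) \<in> lower_central 3"
      using br_in_lower_central[OF _ e3] by simp_all
    moreover have "br e1 (br e1 u) \<notin> lower_central 4"
      using advance[OF e3] u False n_ge_3 by simp
    ultimately have "br u (br e1 u) \<in> span (insert (br e1 (br e1 u)) (lower_central 4))"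
      using lower_central_subset_span_insert[of "br e1 (br e1 u)" 3] False n_ge_3 by auto
    moreover have "span (lower_central 4) = lower_central 4"
      using span_eq_iff subspace_lower_central by blast
    ultimately show ?thesis by (auto simp: span_insert)
  qed
  then obtain a where a: "br u (br e1 u) - scale a (br e1 (br e1 u)) \<in> lower_central 4" by blast
  define e2 where "e2 = u - scale a e1"
  define e where "e i = (if i = 0 then 0 else if i = 1 then e1 else ((br e1) ^^ (i - 2)) e2)" for i
  have e12: "e 1 = e1" "e 2 = e2" by (simp_all add: e_def)
  have e_Suc: "e (Suc i) = br e1 (e i)" if "2 \<le> i" for i
  proof -
    have "Suc i - 2 = Suc (i - 2)" using that by simp
    then show ?thesis using that by (simp add: e_def)
  qed
  have br12: "br e1 e2 = br e1 u" by (simp add: e2_def br_diff_right br_scale_right br_self)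
  then have e_3: "e 3 = br e1 u" using e_Suc[of 2] e12 by simp
  have mem: "e (Suc i) \<in> lower_central i \<and> (i < n \<longrightarrow> e (Suc i) \<notin> lower_central (Suc i))" if "2 \<le> i" for i
    using that
  proof (induction i rule: dec_induct)
    case base
    then show ?case using e_3 e3 u by simp
  next
    case (step i)
    then show ?case
      using e_Suc[of "Suc i"] br_in_lower_central[of i "e (Suc i)" e1] advance[of "e (Suc i)" i] by auto
  qed
  have vanish: "e i = 0" if "n < i" for i
    using that mem[of "i - 1"] lower_central_trivial[of "i - 1"] n_ge_3 by (cases i) auto
  have sub: "lower_central i \<subseteq> span (e ` {Suc i..})" if "2 \<le> i" for i
  proof (cases "n \<le> i")
    case True
    then show ?thesis by (simp add: lower_central_trivial span_zero)
  next
    case False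
    then have "i \<le> n" by simp
    then show ?thesis using that
    proof (induction i rule: inc_induct)
      case base
      then show ?case by (simp add: lower_central_trivial span_zero)
    next
      case (step i)
      have "span (insert (e (Suc i)) (lower_central (Suc i))) \<subseteq> span (e ` {Suc i..})"
      proof (rule span_minimal)
        have "lower_central (Suc i) \<subseteq> span (e ` {Suc (Suc i)..})" using step by simp
        also have "\<dots> \<subseteq> span (e ` {Suc i..})" by (intro span_mono) auto
        finally show "insert (e (Suc i)) (lower_central (Suc i)) \<subseteq> span (e ` {Suc i..})"
          by (auto intro: span_base)
      qed simp
      then show ?case
        using lower_central_subset_span_insert[of "e (Suc i)" i] mem[of i] step by auto
    qed
  qed
  have span: "span (e ` {1..n}) = UNIV"
  proof -
    have sp2: "span (lower_central 2) = lower_central 2"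
      using span_eq_iff subspace_lower_central by blast
    have "e2 \<notin> span (lower_central 2)"
      using br_in_lower_central[of 2 e2 e1] br12 u by (auto simp: sp2)
    moreover have "e1 \<notin> span (insert e2 (lower_central 2))"
    proof
      assume "e1 \<in> span (insert e2 (lower_central 2))"
      then obtain b where b: "e1 - scale b e2 \<in> lower_central 2" by (auto simp: span_insert sp2)
      have "br e1 e2 = br (e1 - scale b e2) e2" by (simp add: br_diff_left br_scale_left br_self)
      then show False using br_in_lower_central'[OF _ b, of e2] br12 u by simp
    qed
    ultimately have "dim (insert e1 (insert e2 (lower_central 2))) = n"
      using dim_lower_central[of 2] n_ge_3 by (simp add: dim_insert)
    then have full: "span (insert e1 (insert e2 (lower_central 2))) = UNIV"
      using dim_eq_full dim_n by (simp add: dimension_def)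
    have "e i \<in> span (e ` {1..n})" if "1 \<le> i" for i
      using that vanish[of i] by (cases "n < i") (auto intro: span_base span_zero)
    then have *: "span (e ` {1..}) \<subseteq> span (e ` {1..n})" by (intro span_minimal) auto
    have "lower_central 2 \<subseteq> span (e ` {3..})" using sub[of 2] by simp
    also have "\<dots> \<subseteq> span (e ` {1..})" by (intro span_mono) auto
    finally have "lower_central 2 \<subseteq> span (e ` {1..n})" using * by blast
    moreover have "e 1 \<in> span (e ` {1..n})" "e 2 \<in> span (e ` {1..n})"
      using n_ge_3 by (auto intro!: span_base)
    ultimately have "span (insert e1 (insert e2 (lower_central 2))) \<subseteq> span (e ` {1..n})"
      using e12 by (intro span_minimal) auto
    then show ?thesis using full by auto
  qed
  have "filiform_adapted_basis scale br Basis e n"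
  proof
    show "br (e 2) (e j) \<in> span (e ` {Suc j..})" if j: "3 \<le> j" for j
    proof -
      obtain i where "j = Suc i" "2 \<le> i" using j by (cases j) auto
      then have "br (e 2) (e j) \<in> lower_central j" using mem[of i] br_in_lower_central[of i "e j"] by auto
      then show ?thesis using sub[of j] j by auto
    qed
    have "br (e 2) (e 3) \<in> lower_central 4"
      using a by (simp add: e12 e_3 e2_def br_diff_left br_scale_left)
    then show "br (e 2) (e 3) \<in> span (e ` {5..})" using sub[of 4] by auto
  qed (use dim_n n_ge_3 e_Suc e12 vanish span in auto)
  then show ?thesis by blast
qed

lemma rentschler_property_le_eleven:
  assumes "n \<le> 11"
  shows rentschler_property
proof -
  obtain e where "filiform_adapted_basis scale br Basis e n" using adapted_basis_exists by blast
  then interpret filiform_adapted_basis scale br Basis e n .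
  show ?thesis using assms by (rule rentschler_property_if_adapted_basis)
qed

end

theorem theorem8p7:
  fixes scale :: "'k::{alg_closed_field, field_char_0} \<Rightarrow> 'l::ab_group_add \<Rightarrow> 'l"
    and br :: "'l \<Rightarrow> 'l \<Rightarrow> 'l" and Basis :: "'l set" and n :: nat
  assumes "finite_dimensional_lie_algebra scale br Basis"
    and "vector_space.dim scale (UNIV :: 'l set) = n"
    and "lie_algebra.filiform scale br"
    and "n \<le> 11"
  shows "lie_algebra.rentschler_property scale br"
proof -
  interpret finite_dimensional_lie_algebra scale br Basis by (rule assms(1))
  show ?thesis
  proof (cases "n \<le> 2")
    case True
    then show ?thesis using rentschler_property_small_dim assms(2,3) by blast
  next
    case False
    interpret filiform_lie_algebra scale br Basis n
      by unfold_locales (use assms(2,3) False in auto)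
    show ?thesis using assms(4) by (rule rentschler_property_le_eleven)
  qed
qed

end
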